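(* Let $\mathcal{B}$ be a Cosserat continuum with second-order non-holonomic material groupoid $\overline\Omega(\mathcal B)$ and let $A\overline{\Omega}(\mathcal{B})$ be its Lie algebroid (the second-order non-holonomic material algebroid). If $\mathcal{B}$ is homogeneous, then $A\overline{\Omega}(\mathcal{B})$ is an integrable non-holonomic prolongation of second order. Conversely, if $A\overline{\Omega}(\mathcal{B})$ is an integrable non-holonomic prolongation of second order, then $\mathcal{B}$ is locally homogeneous.
   Context: Frame bundles. For an $n$-manifold $M$, $FM\to M$ is the linear frame bundle with its right action of $Gl(n,\mathbb R)$; a frame at $x$ is a $1$-jet $j^1_{0,x}\phi$ of a local diffeomorphism $\phi:\mathbb R^n\to M$ with $\phi(0)=x$. For a local diffeomorphism $\psi$, $F\psi(j^1_{0,\phi(0)}\phi)=j^1_{0,\psi(\phi(0))}(\psi\circ\phi)$. $\tau_v$ is translation of $\mathbb R^n$ by $v$. A local principal bundle isomorphism is a diffeomorphism $\Psi:FU\to FV$ with $\Psi(z\cdot g)=\Psi(z)\cdot g$; it induces $\psi:U\to V$. Groupoids. $\Pi^1(M,M)\rightrightarrows M$ is the groupoid of $1$-jets $j^1_{x,y}\psi$ of local diffeomorphisms, with source $\alpha$ and target $\beta$. $\tilde J^1(FM)\rightrightarrows M$ is the quotient of the groupoid of $1$-jets $j^1_{X,Y}\Psi$ of local principal bundle isomorphisms of $FM$ by the action $j^1_{X,Y}\Psi\cdot g=j^1_{X\cdot g,Y\cdot g}\Psi$ of $Gl(n,\mathbb R)$; the class of $j^1_{X,Y}\Psi$, with $X$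 over $x$ and $Y$ over $y$, is written $j^1_{x,y}\Psi$; source $\overline\alpha=x$, target $\overline\beta=y$. Lie algebroid of a Lie groupoid $\Gamma\rightrightarrows M$ (source $\alpha$, target $\beta$, identities $\epsilon$): $A\Gamma_x=T_{\epsilon(x)}\beta^{-1}(x)$, anchor $T\alpha$, bracket from left-invariant vector fields. A Lie groupoid morphism $\Phi$ over the identity induces $A\Phi$ by differentiating $\Phi$ along $\beta$-fibres at identities. For the pair groupoid, $A(M\times M)=TM$; a section $\overline{\mathcal P}:U\times U\to\tilde J^1(FU)$ of $(\overline\alpha,\overline\beta)$ which is a Lie groupoid morphism induces $A\overline{\mathcal P}:TU\to A\tilde J^1(FU)$, $A\overline{\mathcal P}(v_x)=T_x(\overline{\mathcal P}(\cdot,x))(v_x)$. Cosserat media. A body $\mathcal B$ is a $3$-manifold covered by one chart; a Cosserat medium is $F\mathcal B$ (and $\mathcal B$ is called the Cosserat continuum). A configuration is an embedding of principal bundles $F\mathcal B\to F\mathbb R^3$ over the identity of $Gl(3,\mathbb R)$. A reference configuration is fixed and $F\mathcal B$ is identified with its image, so $\mathcal B\subseteq\mathbb R^3$ is open. A deformation is an embedding of principal bundles $\tilde\kappa:F\mathcal B\to F\mathbb R^3$ over the identity of $Gl(3,\mathbb R)$, with induced map $\kappa:\mathcal B\to\mathbb R^3$; $j^1_{y,\kappa(y)}\tilde\kappa$ is an infinitesimal deformation at $y$. The mechanical response is a differentiable map $W:\tilde J^1(F\mathcal B)\to V$ ($V$ a real vector space) with $W(j^1_{x,y}\Psi)=W(j^1_{x,z}(F\tau_{z-y}\circ\Psi))$;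 by this property $W$ is also defined on elements of $\tilde J^1(F\mathbb R^3)$ with source in $\mathcal B$. $\overline\Omega(\mathcal B)$ consists of the $j^1_{x,y}\Psi\in\tilde J^1(F\mathcal B)$ with $W(j^1_{y,\kappa(y)}\tilde\kappa\cdot j^1_{x,y}\Psi)=W(j^1_{y,\kappa(y)}\tilde\kappa)$ for all infinitesimal deformations at $y$. Standing assumption: $\overline\Omega(\mathcal B)$ is a Lie subgroupoid of $\tilde J^1(F\mathcal B)$. Homogeneity. $\mathcal B$ is homogeneous if there is a global deformation $\tilde\kappa$ such that for all $x,y\in\mathcal B$, $j^1_{x,y}(\tilde\kappa^{-1}\circ F\tau_{\kappa(y)-\kappa(x)}\circ\tilde\kappa)\in\overline\Omega(\mathcal B)$. An open $U\subseteq\mathcal B$ is homogeneous if the same holds with a deformation defined over $U$ and $x,y\in U$. $\mathcal B$ is locally homogeneous if it is covered by homogeneous open sets. Prolongations. Let $\mathcal P,\mathcal Q:U\times U\to\Pi^1(U,U)$ be sections of $(\alpha,\beta)$ that are Lie groupoid morphisms from the pair groupoid, with $\mathcal Q(x,y)=j^1_{x,y}\psi_{xy}$. The prolongation is $\mathcal P^1(\mathcal Q)(x,y)=j^1_{x,y}(\overline{\mathcal P\circ\psi_{xy}})\in\tilde J^1(FU)$, where $\overline{\mathcal P\circ\psi_{xy}}(j^1_{0,f(0)}f)=\mathcal P(f(0),\psi_{xy}(f(0)))\cdot j^1_{0,f(0)}f$, and $A\mathcal P^1(A\mathcal Q):=A(\mathcal P^1(\mathcal Q)):TU\to A\tilde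 J^1(FU)$. It is integrable if $\mathcal Q$ is integrable: for all $x_0,y_0\in U$ there are charts $\psi_1,\psi_2$ around $x_0,y_0$ with $\mathcal Q(x,y)=j^1_{x,y}(\psi_2^{-1}\circ\tau_{\psi_2(y)-\psi_1(x)}\circ\psi_1)$ on the product of the chart domains. A Lie subalgebroid of $A\tilde J^1(FM)$ over $M$ is an integrable non-holonomic prolongation of second order if $M$ can be covered by open sets $U$ carrying integrable $A\mathcal P^1(A\mathcal Q)$ with values in the subalgebroid. *)

theory Defs
  imports "HOL-Analysis.Analysis"
begin

section \<open>Smooth maps between open subsets of Euclidean spaces\<close>

text \<open>All domains below are open. On an open set of a finite-dimensional space, \<open>f\<close> is of
  class \<open>C\<^sup>k\<^sup>+\<^sup>1\<close> iff it is differentiable and all its directional derivatives are of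
  class \<open>C\<^sup>k\<close>.\<close>

primrec Ck_on :: "nat \<Rightarrow> 'a::real_normed_vector set \<Rightarrow> ('a \<Rightarrow> 'b::real_normed_vector) \<Rightarrow> bool" where
  "Ck_on 0 S f \<longleftrightarrow> continuous_on S f"
| "Ck_on (Suc k) S f \<longleftrightarrow>
     (\<forall>x\<in>S. f differentiable (at x)) \<and> (\<forall>v. Ck_on k S (\<lambda>x. frechet_derivative f (at x) v))"

definition smooth_on :: "'a::real_normed_vector set \<Rightarrow> ('a \<Rightarrow> 'b::real_normed_vector) \<Rightarrow> bool" where
  "smooth_on S f \<longleftrightarrow> (\<forall>k. Ck_on k S f)"

definition diffeo :: "'a::real_normed_vector set \<Rightarrow> 'b::real_normed_vector set \<Rightarrow> ('a \<Rightarrow> 'b) \<Rightarrow> bool" where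
  "diffeo S T f \<longleftrightarrow> open S \<and> open T \<and> bij_betw f S T \<and>
     smooth_on S f \<and> smooth_on T (inv_into S f)"

definition local_diffeo :: "'a::real_normed_vector set \<Rightarrow> 'b::real_normed_vector set \<Rightarrow> ('a \<Rightarrow> 'b) \<Rightarrow> 'a \<Rightarrow> bool" where
  "local_diffeo S T f x \<longleftrightarrow> (\<exists>V V'. V \<subseteq> S \<and> V' \<subseteq> T \<and> x \<in> V \<and> diffeo V V' f)"

definition embedded_submanifold :: "'a::euclidean_space set \<Rightarrow> bool" where
  "embedded_submanifold S \<longleftrightarrow>
     (\<exists>L. subspace L \<and>
       (\<forall>p\<in>S. \<exists>(N::'a set) (N'::'a set) \<phi>. p \<in> N \<and> diffeo N N' \<phi> \<and> \<phi> ` (S \<inter> N) = L \<inter> N'))"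

definition tangent_space :: "'a::real_normed_vector set \<Rightarrow> 'a \<Rightarrow> 'a set" where
  "tangent_space S p =
     {v. \<exists>\<gamma> e. e > 0 \<and> smooth_on {-e<..<e} \<gamma> \<and> \<gamma> ` {-e<..<e::real} \<subseteq> S \<and> \<gamma> 0 = p \<and>
          (\<gamma> has_vector_derivative v) (at 0)}"


section \<open>Frame bundles of open subsets of \<open>\<real>\<^sup>3\<close>\<close>

type_synonym vec3 = "real^3"
type_synonym mat3 = "real^3^3"

text \<open>The 1-jet of a map at a given point of \<open>\<real>\<^sup>3\<close> is recorded by its value and its Jacobian
  matrix at that point; a frame \<open>j\<^sup>1\<^sub>0\<^sub>,\<^sub>x \<phi>\<close> thus becomes \<open>(\<phi> 0, D\<phi>(0))\<close>.\<close>

type_synonym frame = "vec3 \<times> mat3"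

definition jacobian_at :: "(vec3 \<Rightarrow> vec3) \<Rightarrow> vec3 \<Rightarrow> mat3" where
  "jacobian_at \<phi> x = matrix (frechet_derivative \<phi> (at x))"

definition frame_of :: "(vec3 \<Rightarrow> vec3) \<Rightarrow> frame" where
  "frame_of \<phi> = (\<phi> 0, jacobian_at \<phi> 0)"

definition frame_bundle :: "vec3 set \<Rightarrow> frame set" where
  "frame_bundle U = {frame_of \<phi> | \<phi>. local_diffeo UNIV UNIV \<phi> 0 \<and> \<phi> 0 \<in> U}"

definition frame_act :: "frame \<Rightarrow> mat3 \<Rightarrow> frame" where
  "frame_act X g = (fst X, snd X ** g)"

text \<open>\<open>F\<psi>(j\<^sup>1 \<phi>) = j\<^sup>1(\<psi> \<circ> \<phi>)\<close>, by the chain rule.\<close>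

definition frame_lift :: "(vec3 \<Rightarrow> vec3) \<Rightarrow> frame \<Rightarrow> frame" where
  "frame_lift \<psi> X = (\<psi> (fst X), jacobian_at \<psi> (fst X) ** snd X)"

definition translation :: "vec3 \<Rightarrow> vec3 \<Rightarrow> vec3" where
  "translation v x = x + v"

definition equivariant_on :: "vec3 set \<Rightarrow> (frame \<Rightarrow> frame) \<Rightarrow> bool" where
  "equivariant_on U \<Psi> \<longleftrightarrow>
     (\<forall>X\<in>frame_bundle U. \<forall>g. invertible g \<longrightarrow> \<Psi> (frame_act X g) = frame_act (\<Psi> X) g)"

definition bundle_iso :: "vec3 set \<Rightarrow> vec3 set \<Rightarrow> (frame \<Rightarrow> frame) \<Rightarrow> bool" where
  "bundle_iso U V \<Psi> \<longleftrightarrow> open U \<and> open V \<and>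
     diffeo (frame_bundle U) (frame_bundle V) \<Psi> \<and> equivariant_on U \<Psi>"

text \<open>Base map of an equivariant map; any frame over \<open>x\<close> may be used in place of \<open>(x, mat 1)\<close>.\<close>

definition base_map :: "(frame \<Rightarrow> frame) \<Rightarrow> vec3 \<Rightarrow> vec3" where
  "base_map \<Psi> x = fst (\<Psi> (x, mat 1))"


section \<open>The groupoid of 1-jets of local diffeomorphisms\<close>

text \<open>The jet \<open>j\<^sup>1\<^sub>x\<^sub>,\<^sub>y \<psi>\<close> is recorded as \<open>(x, y, D\<psi>(x))\<close>; this is also its global chart.\<close>

type_synonym pjet = "vec3 \<times> vec3 \<times> mat3"

definition pjet_of :: "(vec3 \<Rightarrow> vec3) \<Rightarrow> vec3 \<Rightarrow> pjet" where
  "pjet_of \<psi> x = (x, \<psi> x, jacobian_at \<psi> x)"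

definition Pi1 :: "vec3 set \<Rightarrow> pjet set" where
  "Pi1 U = {pjet_of \<psi> x | \<psi> x. local_diffeo U U \<psi> x}"

definition psource :: "pjet \<Rightarrow> vec3" where
  "psource p = fst p"

definition ptarget :: "pjet \<Rightarrow> vec3" where
  "ptarget p = fst (snd p)"

definition pcomp :: "pjet \<Rightarrow> pjet \<Rightarrow> pjet" where
  "pcomp q p = (psource p, ptarget q, snd (snd q) ** snd (snd p))"

text \<open>Composition of a jet \<open>j\<^sup>1\<^sub>x\<^sub>,\<^sub>y \<psi>\<close> with a frame at \<open>x\<close>.\<close>

definition pjet_frame :: "pjet \<Rightarrow> frame \<Rightarrow> frame" where
  "pjet_frame p X = (ptarget p, snd (snd p) ** snd X)"

text \<open>Sections of \<open>(\<alpha>, \<beta>)\<close> which are Lie groupoid morphisms from the pair groupoid, where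
  \<open>(x, y)\<close> has source \<open>x\<close> and target \<open>y\<close>.\<close>

definition parallelism :: "vec3 set \<Rightarrow> (vec3 \<times> vec3 \<Rightarrow> pjet) \<Rightarrow> bool" where
  "parallelism U P \<longleftrightarrow>
     (\<forall>x\<in>U. \<forall>y\<in>U. P (x, y) \<in> Pi1 U \<and> psource (P (x, y)) = x \<and> ptarget (P (x, y)) = y) \<and>
     (\<forall>x\<in>U. \<forall>y\<in>U. \<forall>z\<in>U. P (x, z) = pcomp (P (y, z)) (P (x, y))) \<and>
     smooth_on (U \<times> U) P"

definition chart_around :: "vec3 set \<Rightarrow> vec3 \<Rightarrow> vec3 set \<Rightarrow> (vec3 \<Rightarrow> vec3) \<Rightarrow> bool" where
  "chart_around U x V \<psi> \<longleftrightarrow> x \<in> V \<and> V \<subseteq> U \<and> diffeo V (\<psi> ` V) \<psi>"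

definition integrable_parallelism :: "vec3 set \<Rightarrow> (vec3 \<times> vec3 \<Rightarrow> pjet) \<Rightarrow> bool" where
  "integrable_parallelism U Q \<longleftrightarrow>
     (\<forall>x0\<in>U. \<forall>y0\<in>U. \<exists>V1 \<psi>1 V2 \<psi>2. chart_around U x0 V1 \<psi>1 \<and> chart_around U y0 V2 \<psi>2 \<and>
        (\<forall>x\<in>V1. \<forall>y\<in>V2.
           Q (x, y) = pjet_of (inv_into V2 \<psi>2 \<circ> translation (\<psi>2 y - \<psi>1 x) \<circ> \<psi>1) x))"


section \<open>The second-order non-holonomic groupoid\<close>

text \<open>A 1-jet \<open>j\<^sup>1\<^sub>X\<^sub>,\<^sub>Y \<Psi>\<close> is recorded as \<open>(X, Y, D\<Psi>(X))\<close>, an element of the quotient as an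
  orbit, i.e. a set of such triples. The group acts simply transitively on the frames over \<open>x\<close>,
  so the orbit of \<open>j\<^sup>1\<^sub>X\<^sub>,\<^sub>Y \<Psi>\<close> under \<open>j\<^sup>1\<^sub>X\<^sub>,\<^sub>Y \<Psi> \<cdot> g = j\<^sup>1\<^sub>X\<^sub>g\<^sub>,\<^sub>Y\<^sub>g \<Psi>\<close> consists of the jets of
  \<open>\<Psi>\<close> at all frames over \<open>x\<close>.\<close>

type_synonym fjet = "frame \<times> frame \<times> (frame \<Rightarrow> frame)"
type_synonym nhjet = "fjet set"

definition fjet_of :: "(frame \<Rightarrow> frame) \<Rightarrow> frame \<Rightarrow> fjet" where
  "fjet_of \<Psi> X = (X, \<Psi> X, frechet_derivative \<Psi> (at X))"

definition nhjet_of :: "(frame \<Rightarrow> frame) \<Rightarrow> vec3 \<Rightarrow> nhjet" where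
  "nhjet_of \<Psi> x = {fjet_of \<Psi> X | X. X \<in> frame_bundle {x}}"

definition J1 :: "vec3 set \<Rightarrow> nhjet set" where
  "J1 U = {nhjet_of \<Psi> x | \<Psi> x V V'. bundle_iso V V' \<Psi> \<and> V \<subseteq> U \<and> V' \<subseteq> U \<and> x \<in> V}"

definition unit_rep :: "nhjet \<Rightarrow> fjet" where
  "unit_rep p = (THE t. t \<in> p \<and> snd (fst t) = mat 1)"

definition source :: "nhjet \<Rightarrow> vec3" where
  "source p = fst (fst (unit_rep p))"

definition target :: "nhjet \<Rightarrow> vec3" where
  "target p = fst (fst (snd (unit_rep p)))"

definition nhunit :: "vec3 \<Rightarrow> nhjet" where
  "nhunit x = nhjet_of id x"

text \<open>Orbits are composed by composing representatives with matching frames; this is meaningful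
  only if \<open>source q = target p\<close>.\<close>

definition nhcomp :: "nhjet \<Rightarrow> nhjet \<Rightarrow> nhjet"  (infixl "\<odot>" 70) where
  "q \<odot> p = {(X, Z, E \<circ> D) | X Y Z D E. (X, Y, D) \<in> p \<and> (Y, Z, E) \<in> q}"

definition nhinv :: "nhjet \<Rightarrow> nhjet" where
  "nhinv p = {(Y, X, inv D) | X Y D. (X, Y, D) \<in> p}"

text \<open>The global chart of the quotient manifold given by the slice \<open>X = (x, mat 1)\<close>. If
  \<open>\<Psi>(x, A) = (\<psi> x, P x ** A)\<close>, the class of the jet of \<open>\<Psi>\<close> over \<open>x\<close> has coordinates
  \<open>(x, \<psi> x, P x, D\<psi>(x), (\<partial>\<^sub>k P(x))\<^sub>k)\<close>; these determine the class, since
  \<open>D\<Psi>(x, mat 1)\<close> maps \<open>(0, B)\<close> to \<open>(0, P x ** B)\<close>.\<close>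

type_synonym nhcoord = "vec3 \<times> vec3 \<times> mat3 \<times> mat3 \<times> (mat3^3)"

definition coords :: "nhjet \<Rightarrow> nhcoord" where
  "coords p = (let (X, Y, D) = unit_rep p in
     (fst X, fst Y, snd Y, matrix (\<lambda>v. fst (D (v, 0))), (\<chi> k. snd (D (axis k 1, 0)))))"

text \<open>Lie subgroupoid over \<open>B\<close>. Restrictions of the structure maps of \<open>J1 B\<close> to an embedded
  submanifold are smooth, so of the differentiable axioms of a Lie groupoid only the
  submersivity of source and target (the first two coordinates) has to be required.\<close>

definition lie_subgroupoid :: "vec3 set \<Rightarrow> nhjet set \<Rightarrow> bool" where
  "lie_subgroupoid B \<Omega> \<longleftrightarrow>
     \<Omega> \<subseteq> J1 B \<and>
     (\<forall>x\<in>B. nhunit x \<in> \<Omega>) \<and>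
     (\<forall>p\<in>\<Omega>. \<forall>q\<in>\<Omega>. source q = target p \<longrightarrow> q \<odot> p \<in> \<Omega>) \<and>
     (\<forall>p\<in>\<Omega>. nhinv p \<in> \<Omega>) \<and>
     embedded_submanifold (coords ` \<Omega>) \<and>
     (\<forall>p\<in>\<Omega>. fst ` tangent_space (coords ` \<Omega>) (coords p) = UNIV \<and>
              (fst \<circ> snd) ` tangent_space (coords ` \<Omega>) (coords p) = UNIV)"

text \<open>The fibre over \<open>x\<close> of the Lie algebroid, the tangent space of the target fibre at the unit,
  in the chart \<^const>\<open>coords\<close>.\<close>

definition algebroid :: "nhjet set \<Rightarrow> vec3 \<Rightarrow> nhcoord set" where
  "algebroid \<Omega> x = tangent_space (coords ` {p \<in> \<Omega>. target p = x}) (coords (nhunit x))"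

definition induced_algebroid_map :: "(vec3 \<times> vec3 \<Rightarrow> nhjet) \<Rightarrow> vec3 \<Rightarrow> vec3 \<Rightarrow> nhcoord" where
  "induced_algebroid_map S x v = frechet_derivative (\<lambda>y. coords (S (y, x))) (at x) v"


section \<open>Prolongations\<close>

text \<open>\<open>\<psi>\<close> is any local diffeomorphism of \<open>U\<close> with \<open>j\<^sup>1\<^sub>x\<^sub>,\<^sub>y \<psi> = Q(x, y)\<close>; the result only
  depends on its 1-jet.\<close>

definition prolongation ::
    "vec3 set \<Rightarrow> (vec3 \<times> vec3 \<Rightarrow> pjet) \<Rightarrow> (vec3 \<times> vec3 \<Rightarrow> pjet) \<Rightarrow> vec3 \<times> vec3 \<Rightarrow> nhjet" where
  "prolongation U P Q = (\<lambda>(x, y).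
     let \<psi> = (SOME \<psi>. local_diffeo U U \<psi> x \<and> pjet_of \<psi> x = Q (x, y))
     in nhjet_of (\<lambda>X. pjet_frame (P (fst X, \<psi> (fst X))) X) x)"

text \<open>This property of a Lie subalgebroid of the Lie algebroid of \<open>J1 B\<close> only involves its
  fibres \<open>A x\<close>.\<close>

definition integrable_nonholonomic_prolongation :: "vec3 set \<Rightarrow> (vec3 \<Rightarrow> nhcoord set) \<Rightarrow> bool" where
  "integrable_nonholonomic_prolongation B A \<longleftrightarrow>
     (\<forall>x\<in>B. \<exists>U P Q. open U \<and> x \<in> U \<and> U \<subseteq> B \<and> parallelism U P \<and> parallelism U Q \<and>
        integrable_parallelism U Q \<and>
        (\<forall>z\<in>U. \<forall>v. induced_algebroid_map (prolongation U P Q) z v \<in> A z))"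


section \<open>Cosserat media\<close>

text \<open>The body is identified with an open set \<open>B\<close> via the reference configuration.\<close>

definition deformation :: "vec3 set \<Rightarrow> (frame \<Rightarrow> frame) \<Rightarrow> bool" where
  "deformation U \<kappa> \<longleftrightarrow>
     \<kappa> ` frame_bundle U \<subseteq> frame_bundle UNIV \<and> equivariant_on U \<kappa> \<and>
     smooth_on (frame_bundle U) \<kappa> \<and>
     (\<forall>X\<in>frame_bundle U. inj (frechet_derivative \<kappa> (at X))) \<and>
     embedding_map (top_of_set (frame_bundle U)) (top_of_set (frame_bundle UNIV)) \<kappa>"

text \<open>If \<open>p = j\<^sup>1\<^sub>x\<^sub>,\<^sub>y \<Psi>\<close>, this is \<open>j\<^sup>1\<^sub>x\<^sub>,\<^sub>z (F\<tau>\<^sub>z\<^sub>-\<^sub>y \<circ> \<Psi>)\<close>.\<close>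

definition translate_to :: "vec3 \<Rightarrow> nhjet \<Rightarrow> nhjet" where
  "translate_to z p = nhjet_of (frame_lift (translation (z - target p))) (target p) \<odot> p"

definition mechanical_response :: "vec3 set \<Rightarrow> (nhjet \<Rightarrow> 'v::real_normed_vector) \<Rightarrow> bool" where
  "mechanical_response B W \<longleftrightarrow>
     (W \<circ> inv_into (J1 B) coords) differentiable_on (coords ` J1 B) \<and>
     (\<forall>p\<in>J1 B. \<forall>z\<in>B. W (translate_to z p) = W p)"

text \<open>Extension of \<open>W\<close> to jets with source in \<open>B\<close> and arbitrary target: by invariance, any
  point of \<open>B\<close> may be used in place of \<open>source p\<close>.\<close>

definition extended_response :: "(nhjet \<Rightarrow> 'v) \<Rightarrow> nhjet \<Rightarrow> 'v" where
  "extended_response W p = W (translate_to (source p) p)"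

definition material_groupoid :: "vec3 set \<Rightarrow> (nhjet \<Rightarrow> 'v) \<Rightarrow> nhjet set" where
  "material_groupoid B W = {p \<in> J1 B. \<forall>\<kappa>. deformation B \<kappa> \<longrightarrow>
     extended_response W (nhjet_of \<kappa> (target p) \<odot> p) =
     extended_response W (nhjet_of \<kappa> (target p))}"

definition homogeneous_on :: "nhjet set \<Rightarrow> vec3 set \<Rightarrow> bool" where
  "homogeneous_on \<Omega> U \<longleftrightarrow>
     (\<exists>\<kappa>. deformation U \<kappa> \<and>
       (\<forall>x\<in>U. \<forall>y\<in>U.
          nhjet_of (inv_into (frame_bundle U) \<kappa> \<circ>
                    frame_lift (translation (base_map \<kappa> y - base_map \<kappa> x)) \<circ> \<kappa>) x \<in> \<Omega>))"

definition homogeneous :: "vec3 set \<Rightarrow> nhjet set \<Rightarrow> bool" where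
  "homogeneous B \<Omega> \<longleftrightarrow> homogeneous_on \<Omega> B"

definition locally_homogeneous :: "vec3 set \<Rightarrow> nhjet set \<Rightarrow> bool" where
  "locally_homogeneous B \<Omega> \<longleftrightarrow>
     (\<forall>x\<in>B. \<exists>U. open U \<and> x \<in> U \<and> U \<subseteq> B \<and> homogeneous_on \<Omega> U)"

end

theory Submission
  imports Defs
begin

text \<open>
  In suitable coordinates a homogeneity jet of a deformation \<open>\<kappa>(x, A) = (k x, p x ** A)\<close> is the
  prolongation jet of the two cocycles \<open>p(y)\<^sup>-\<^sup>1 p(x)\<close> and \<open>Dk(y)\<^sup>-\<^sup>1 Dk(x)\<close>. Hence homogeneity
  yields curves of prolongation jets in the target fibres of \<open>\<Omega>\<close>, and their velocities are the required
  elements of the algebroid. Conversely, for a prolongation \<open>S\<close> of \<open>P\<close> and \<open>Q\<close> with values in the algebroid,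
  the curve \<open>t \<mapsto> S(z + t v, z)\<close> is an integral curve of a left-invariant vector field tangent to \<open>\<Omega>\<close>.
  A Gronwall estimate in a slice chart keeps it in \<open>\<Omega>\<close> for small \<open>t\<close>; as \<open>S(x, y) \<in> \<Omega>\<close> is an
  equivalence relation with open classes, it holds on every ball. Integrability of \<open>Q\<close> gives \<open>k\<close> with
  \<open>Q(x, y) = Dk(y)\<^sup>-\<^sup>1 Dk(x)\<close>, and \<open>p(x) = P(x, x\<^sub>0)\<close> completes a deformation whose homogeneity jets are
  the values of \<open>S\<close>.
\<close>

section \<open>Calculus of smooth maps\<close>

text \<open>The converse calls for no flow and no uniqueness theorem: the integral curve is given
  explicitly by the morphism \<open>S\<close>, and only its coordinate transverse to
  \<open>\<Omega>\<close> has to be controlled. The vector field has zero transverse part on the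
  slice, so a Lipschitz bound makes its transverse part at most a constant times the transverse
  coordinate, which therefore stays at its initial value zero. An embedded submanifold need not be
  closed, so the parameters for which a curve lies in \<open>\<Omega>\<close> do not visibly form a
  closed set. The groupoid operations replace the missing closedness: they make all classes of an
  equivalence relation open at once, and connectedness of an interval does the rest. Only local
  homogeneity comes out because charts adapted to \<open>Q\<close>, and convex neighbourhoods inside
  their domains, are available only near a point. Orbits are handled through the global chart
  \<open>coords\<close>, where identities between jets become matrix identities together with their
  derivatives.\<close>

lemma Ck_on_cong:
  assumes "open S" "\<And>x. x \<in> S \<Longrightarrow> f x = g x" "Ck_on k S f"
  shows "Ck_on k S g"
  using assms(2,3)
proof (induction k arbitrary: f g)
  case 0
  then show ?case by (simp cong: continuous_on_cong)
next
  case (Suc k)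
  have "g differentiable (at x) \<and> frechet_derivative f (at x) = frechet_derivative g (at x)"
    if "x \<in> S" for x
  proof -
    have "(f has_derivative frechet_derivative f (at x)) (at x)"
      using Suc.prems that by (simp add: frechet_derivative_works)
    then have "(g has_derivative frechet_derivative f (at x)) (at x)"
      using has_derivative_transform_within_open[OF _ \<open>open S\<close> that] Suc.prems(1) by blast
    then show ?thesis
      using frechet_derivative_at differentiable_def by blast
  qed
  moreover have "Ck_on k S (\<lambda>x. frechet_derivative g (at x) v)" for v
    using Suc.IH[of "\<lambda>x. frechet_derivative f (at x) v" "\<lambda>x. frechet_derivative g (at x) v"]
      Suc.prems(2) calculation by simp
  ultimately show ?case by simp
qed

text \<open>\<open>Ck_on\<close> refers to the derivative picked by
  \<open>frechet_derivative\<close>. Uniqueness of derivatives on an open set lets any explicit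
  formula take its place, which is how the inductions on the order of smoothness proceed.\<close>

lemma Ck_on_SucI:
  assumes "open S" "\<And>x. x \<in> S \<Longrightarrow> (f has_derivative f' x) (at x)"
    and "\<And>v. Ck_on k S (\<lambda>x. f' x v)"
  shows "Ck_on (Suc k) S f"
proof -
  have "f' x = frechet_derivative f (at x)" if "x \<in> S" for x
    using frechet_derivative_at[OF assms(2)[OF that]] .
  then have "Ck_on k S (\<lambda>x. frechet_derivative f (at x) v)" for v
    using Ck_on_cong[OF assms(1) _ assms(3)[of v]] by simp
  then show ?thesis
    using assms(2) by (auto simp: differentiable_def)
qed

lemma Ck_on_Suc_has_derivative:
  "Ck_on (Suc k) S f \<Longrightarrow> x \<in> S \<Longrightarrow> (f has_derivative frechet_derivative f (at x)) (at x)"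
  by (simp add: frechet_derivative_works)

lemma Ck_on_imp_continuous_on: "Ck_on k S f \<Longrightarrow> continuous_on S f"
  by (cases k) (auto intro!: continuous_at_imp_continuous_on differentiable_imp_continuous_within)

lemma Ck_on_Suc_imp: "Ck_on (Suc k) S f \<Longrightarrow> Ck_on k S f"
proof (induction k arbitrary: f)
  case 0
  show ?case using Ck_on_imp_continuous_on[OF 0] by simp
next
  case (Suc k)
  have "Ck_on k S (\<lambda>x. frechet_derivative f (at x) v)" for v
    by (rule Suc.IH) (use Suc.prems in simp)
  then show ?case using Suc.prems by simp
qed

lemma Ck_on_subset: "Ck_on k S f \<Longrightarrow> T \<subseteq> S \<Longrightarrow> Ck_on k T f"
  by (induction k arbitrary: f) (auto intro: continuous_on_subset)

lemma Ck_on_const: "Ck_on k S (\<lambda>x. c)"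
  by (induction k arbitrary: c) auto

lemma Ck_on_linear_comp:
  assumes "open S" "bounded_linear L" "Ck_on k S f"
  shows "Ck_on k S (\<lambda>x. L (f x))"
  using assms(3)
proof (induction k arbitrary: f)
  case 0
  then show ?case using assms(2) bounded_linear.continuous_on by simp blast
next
  case (Suc k)
  show ?case
  proof (rule Ck_on_SucI[OF \<open>open S\<close>])
    show "((\<lambda>x. L (f x)) has_derivative (\<lambda>v. L (frechet_derivative f (at x) v))) (at x)" if "x \<in> S" for x
      using bounded_linear.has_derivative[OF assms(2) Ck_on_Suc_has_derivative[OF Suc.prems that]] .
    show "Ck_on k S (\<lambda>x. L (frechet_derivative f (at x) v))" for v
      using Suc.IH Suc.prems by simp
  qed
qed

lemma Ck_on_linear:
  assumes "open S" "bounded_linear L"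
  shows "Ck_on k S L"
proof (cases k)
  case 0
  then show ?thesis using assms(2) linear_continuous_on by auto
next
  case (Suc k)
  show ?thesis unfolding Suc
    by (rule Ck_on_SucI[OF \<open>open S\<close> bounded_linear_imp_has_derivative[OF assms(2)] Ck_on_const])
qed

lemma Ck_on_add:
  assumes "open S" "Ck_on k S f" "Ck_on k S g"
  shows "Ck_on k S (\<lambda>x. f x + g x)"
  using assms(2,3)
proof (induction k arbitrary: f g)
  case 0
  then show ?case by (simp add: continuous_on_add)
next
  case (Suc k)
  show ?case
  proof (rule Ck_on_SucI[OF \<open>open S\<close>])
    show "((\<lambda>x. f x + g x) has_derivative
        (\<lambda>v. frechet_derivative f (at x) v + frechet_derivative g (at x) v)) (at x)" if "x \<in> S" for x
      using Ck_on_Suc_has_derivative[OF Suc.prems(1) that] Ck_on_Suc_has_derivative[OF Suc.prems(2) that]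
      by (rule has_derivative_add)
  qed (use Suc in auto)
qed

lemma Ck_on_sum:
  assumes "open S" "\<And>i. i \<in> I \<Longrightarrow> Ck_on k S (f i)"
  shows "Ck_on k S (\<lambda>x. \<Sum>i\<in>I. f i x)"
  using assms(2) by (induction I rule: infinite_finite_induct) (auto intro: Ck_on_const Ck_on_add[OF \<open>open S\<close>])

lemma Ck_on_bilinear:
  assumes "open S" "bounded_bilinear P" "Ck_on k S f" "Ck_on k S g"
  shows "Ck_on k S (\<lambda>x. P (f x) (g x))"
  using assms(3,4)
proof (induction k arbitrary: f g)
  case 0
  then show ?case using bounded_bilinear.continuous_on[OF assms(2)] by simp
next
  case (Suc k)
  show ?case
  proof (rule Ck_on_SucI[OF \<open>open S\<close>])
    show "((\<lambda>x. P (f x) (g x)) has_derivative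
        (\<lambda>v. P (f x) (frechet_derivative g (at x) v) + P (frechet_derivative f (at x) v) (g x))) (at x)"
      if "x \<in> S" for x
      using bounded_bilinear.FDERIV[OF assms(2) Ck_on_Suc_has_derivative[OF Suc.prems(1) that]
          Ck_on_Suc_has_derivative[OF Suc.prems(2) that]] .
    show "Ck_on k S (\<lambda>x. P (f x) (frechet_derivative g (at x) v) + P (frechet_derivative f (at x) v) (g x))"
      for v
      using Suc.prems Suc.prems[THEN Ck_on_Suc_imp] by (intro Ck_on_add[OF \<open>open S\<close>] Suc.IH) simp_all
  qed
qed

lemma linear_sum_Basis:
  fixes L :: "'a::euclidean_space \<Rightarrow> 'b::real_vector"
  assumes "linear L"
  shows "L w = (\<Sum>b\<in>Basis. (w \<bullet> b) *\<^sub>R L b)"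
proof -
  have "L w = L (\<Sum>b\<in>Basis. (w \<bullet> b) *\<^sub>R b)" by (simp add: euclidean_representation)
  also have "\<dots> = (\<Sum>b\<in>Basis. (w \<bullet> b) *\<^sub>R L b)"
    using assms by (simp add: linear_sum linear_cmul)
  finally show ?thesis .
qed

text \<open>The chain rule evaluates the derivative of \<open>g\<close> in a direction that varies
  with \<open>x\<close>, whereas \<open>Ck_on\<close> speaks of fixed directions. Expanding that
  direction over \<open>Basis\<close> leaves a sum of products whose factors are covered by the
  induction hypothesis, which is general in \<open>g\<close>.\<close>

lemma Ck_on_compose:
  fixes f :: "'a::real_normed_vector \<Rightarrow> 'b::euclidean_space"
  assumes "open S" "open T" "Ck_on k T g" "Ck_on k S f" "\<And>x. x \<in> S \<Longrightarrow> f x \<in> T"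
  shows "Ck_on k S (\<lambda>x. g (f x))"
  using assms(3,4)
proof (induction k arbitrary: g)
  case 0
  then show ?case using assms(5) by (auto intro: continuous_on_compose2)
next
  case (Suc k)
  show ?case
  proof (rule Ck_on_SucI[OF \<open>open S\<close>])
    fix x assume "x \<in> S"
    have "((\<lambda>x. g (f x)) has_derivative
        (\<lambda>v. frechet_derivative g (at (f x)) (frechet_derivative f (at x) v))) (at x)"
      using has_derivative_compose[OF Ck_on_Suc_has_derivative[OF Suc.prems(2) \<open>x \<in> S\<close>]
          Ck_on_Suc_has_derivative[OF Suc.prems(1) assms(5)[OF \<open>x \<in> S\<close>]]] .
    moreover have "linear (frechet_derivative g (at (f x)))"
      using Suc.prems(1) assms(5)[OF \<open>x \<in> S\<close>] linear_frechet_derivative by auto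
    ultimately show "((\<lambda>x. g (f x)) has_derivative
        (\<lambda>v. \<Sum>b\<in>Basis. (frechet_derivative f (at x) v \<bullet> b) *\<^sub>R frechet_derivative g (at (f x)) b)) (at x)"
      by (subst (asm) linear_sum_Basis) auto
  next
    fix v
    show "Ck_on k S (\<lambda>x. \<Sum>b\<in>Basis. (frechet_derivative f (at x) v \<bullet> b) *\<^sub>R frechet_derivative g (at (f x)) b)"
    proof (intro Ck_on_sum[OF \<open>open S\<close>] Ck_on_bilinear[OF \<open>open S\<close> bounded_bilinear_scaleR])
      fix b :: 'b
      show "Ck_on k S (\<lambda>x. frechet_derivative f (at x) v \<bullet> b)"
        using Suc.prems(2) by (intro Ck_on_linear_comp[OF \<open>open S\<close> bounded_linear_inner_left]) simp
      show "Ck_on k S (\<lambda>x. frechet_derivative g (at (f x)) b)"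
        using Suc.prems(1) Ck_on_Suc_imp[OF Suc.prems(2)] by (intro Suc.IH) auto
    qed
  qed
qed

lemma smooth_on_cong:
  "open S \<Longrightarrow> (\<And>x. x \<in> S \<Longrightarrow> f x = g x) \<Longrightarrow> smooth_on S f \<Longrightarrow> smooth_on S g"
  unfolding smooth_on_def using Ck_on_cong by blast

lemma smooth_on_subset: "smooth_on S f \<Longrightarrow> T \<subseteq> S \<Longrightarrow> smooth_on T f"
  unfolding smooth_on_def using Ck_on_subset by blast

lemma smooth_on_const: "smooth_on S (\<lambda>x. c)"
  by (simp add: smooth_on_def Ck_on_const)

lemma smooth_on_linear_comp:
  "open S \<Longrightarrow> bounded_linear L \<Longrightarrow> smooth_on S f \<Longrightarrow> smooth_on S (\<lambda>x. L (f x))"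
  by (simp add: smooth_on_def Ck_on_linear_comp)

lemma smooth_on_linear: "open S \<Longrightarrow> bounded_linear L \<Longrightarrow> smooth_on S L"
  by (simp add: smooth_on_def Ck_on_linear)

lemma smooth_on_ident: "open S \<Longrightarrow> smooth_on S (\<lambda>x. x)"
  by (simp add: smooth_on_linear bounded_linear_ident)

lemma smooth_on_add:
  "open S \<Longrightarrow> smooth_on S f \<Longrightarrow> smooth_on S g \<Longrightarrow> smooth_on S (\<lambda>x. f x + g x)"
  by (simp add: smooth_on_def Ck_on_add)

lemma smooth_on_sum:
  "open S \<Longrightarrow> (\<And>i. i \<in> I \<Longrightarrow> smooth_on S (f i)) \<Longrightarrow> smooth_on S (\<lambda>x. \<Sum>i\<in>I. f i x)"
  by (simp add: smooth_on_def Ck_on_sum)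

lemma smooth_on_bilinear:
  "open S \<Longrightarrow> bounded_bilinear P \<Longrightarrow> smooth_on S f \<Longrightarrow> smooth_on S g \<Longrightarrow>
    smooth_on S (\<lambda>x. P (f x) (g x))"
  by (simp add: smooth_on_def Ck_on_bilinear)

lemma smooth_on_compose:
  fixes f :: "'a::real_normed_vector \<Rightarrow> 'b::euclidean_space"
  shows "open S \<Longrightarrow> open T \<Longrightarrow> smooth_on T g \<Longrightarrow> smooth_on S f \<Longrightarrow> (\<And>x. x \<in> S \<Longrightarrow> f x \<in> T) \<Longrightarrow>
    smooth_on S (\<lambda>x. g (f x))"
  by (simp add: smooth_on_def Ck_on_compose)

lemma smooth_on_diff:
  assumes "open S" "smooth_on S f" "smooth_on S g"
  shows "smooth_on S (\<lambda>x. f x - g x)"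
  using smooth_on_add[OF assms(1,2) smooth_on_linear_comp[OF assms(1)
        bounded_linear_minus[OF bounded_linear_ident] assms(3)]] by simp

lemma smooth_on_fst: "open S \<Longrightarrow> smooth_on S f \<Longrightarrow> smooth_on S (\<lambda>x. fst (f x))"
  by (rule smooth_on_linear_comp[OF _ bounded_linear_fst])

lemma smooth_on_snd: "open S \<Longrightarrow> smooth_on S f \<Longrightarrow> smooth_on S (\<lambda>x. snd (f x))"
  by (rule smooth_on_linear_comp[OF _ bounded_linear_snd])

lemma smooth_on_Pair:
  assumes "open S" "smooth_on S f" "smooth_on S g"
  shows "smooth_on S (\<lambda>x. (f x, g x))"
proof -
  have "bounded_linear (\<lambda>z::'b. (z, 0::'c))" "bounded_linear (\<lambda>z::'c. (0::'b, z))"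
    by (intro bounded_linear_Pair bounded_linear_ident bounded_linear_zero)+
  from smooth_on_add[OF assms(1) smooth_on_linear_comp[OF assms(1) this(1) assms(2)]
      smooth_on_linear_comp[OF assms(1) this(2) assms(3)]]
  show ?thesis by simp
qed

lemma bounded_linear_axis:
  "bounded_linear (\<lambda>x::'a::euclidean_space. axis i x :: 'a^'n)"
  by (intro linear_conv_bounded_linear[THEN iffD1] linearI) (simp_all add: axis_def vec_eq_iff)

lemma smooth_on_vec_lambda:
  fixes f :: "'n::finite \<Rightarrow> 'a::real_normed_vector \<Rightarrow> 'b::euclidean_space"
  assumes "open S" "\<And>i. smooth_on S (f i)"
  shows "smooth_on S (\<lambda>x. \<chi> i. f i x)"
proof -
  have "smooth_on S (\<lambda>x. \<Sum>i\<in>UNIV. axis i (f i x))"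
    by (intro smooth_on_sum smooth_on_linear_comp[OF _ bounded_linear_axis] assms)
  moreover have "(\<Sum>i\<in>UNIV. axis i (f i x)) = (\<chi> i. f i x)" for x
    by (auto simp: vec_eq_iff axis_def if_distrib[of "\<lambda>g. g $ _"] cong: if_cong)
  ultimately show ?thesis by simp
qed

lemma smooth_on_vec_nth:
  "open S \<Longrightarrow> smooth_on S f \<Longrightarrow> smooth_on S (\<lambda>x. f x $ i)"
  by (rule smooth_on_linear_comp[OF _ bounded_linear_vec_nth])

lemma smooth_on_imp_continuous_on: "smooth_on S f \<Longrightarrow> continuous_on S f"
  using Ck_on_imp_continuous_on smooth_on_def by blast

lemma smooth_on_has_derivative:
  "smooth_on S f \<Longrightarrow> x \<in> S \<Longrightarrow> (f has_derivative frechet_derivative f (at x)) (at x)"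
  using Ck_on_Suc_has_derivative smooth_on_def by blast

lemma smooth_on_linear_frechet_derivative:
  "smooth_on S f \<Longrightarrow> x \<in> S \<Longrightarrow> linear (frechet_derivative f (at x))"
  using smooth_on_has_derivative has_derivative_linear by blast

text \<open>Smoothness jointly in the base point and the direction, by the same expansion over
  \<open>Basis\<close> as in the chain rule. Jacobians, prolongations and left-invariant fields are
  all of this shape.\<close>

lemma smooth_on_frechet_derivative:
  fixes g :: "'a::real_normed_vector \<Rightarrow> 'b::euclidean_space"
  assumes "open S" "open T" "smooth_on T f" "smooth_on S g" "smooth_on S w"
    and "\<And>x. x \<in> S \<Longrightarrow> g x \<in> T"
  shows "smooth_on S (\<lambda>x. frechet_derivative f (at (g x)) (w x))"
proof -
  have "smooth_on T (\<lambda>y. frechet_derivative f (at y) b)" for b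
    using assms(3) unfolding smooth_on_def by (metis Ck_on.simps(2))
  then have "smooth_on S (\<lambda>x. \<Sum>b\<in>Basis. (w x \<bullet> b) *\<^sub>R frechet_derivative f (at (g x)) b)"
    using smooth_on_compose[OF assms(1,2) _ assms(4,6)] assms(1,5)
    by (intro smooth_on_sum smooth_on_bilinear[OF _ bounded_bilinear_scaleR]
        smooth_on_linear_comp[OF _ bounded_linear_inner_left]) auto
  then show ?thesis
    by (rule smooth_on_cong[OF assms(1), rotated])
       (metis assms(3,6) linear_sum_Basis smooth_on_linear_frechet_derivative)
qed


section \<open>Smoothness of inverses\<close>

lemma bounded_bilinear_matrix_mult:
  "bounded_bilinear ((**) :: real^'n^'m \<Rightarrow> real^'k^'n \<Rightarrow> real^'k^'m)"
  unfolding bilinear_conv_bounded_bilinear[symmetric] bilinear_def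
  by (auto intro!: linearI simp: matrix_add_ldistrib matrix_scalar_ac scalar_matrix_assoc
      matrix_matrix_mult_def vec_eq_iff sum.distrib sum_distrib_left algebra_simps)

lemma bounded_bilinear_matrix_vector_mult:
  "bounded_bilinear ((*v) :: real^'n^'m \<Rightarrow> real^'n \<Rightarrow> real^'m)"
  unfolding bilinear_conv_bounded_bilinear[symmetric] bilinear_def
  by (auto intro!: linearI simp: matrix_vector_mult_def vec_eq_iff sum.distrib sum_distrib_left algebra_simps)

lemma smooth_on_prod:
  fixes f :: "'i \<Rightarrow> 'a::real_normed_vector \<Rightarrow> real"
  assumes "open S" "\<And>i. i \<in> I \<Longrightarrow> smooth_on S (f i)"
  shows "smooth_on S (\<lambda>x. \<Prod>i\<in>I. f i x)"
  using assms(2) by (induction I rule: infinite_finite_induct)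
    (auto intro: smooth_on_const smooth_on_bilinear[OF \<open>open S\<close> bounded_bilinear_mult])

lemma smooth_on_det: "smooth_on UNIV (det :: real^'n^'n \<Rightarrow> real)"
  unfolding det_def
  by (intro smooth_on_sum smooth_on_bilinear[OF _ bounded_bilinear_mult] smooth_on_prod
      smooth_on_const smooth_on_vec_nth smooth_on_ident) simp_all

text \<open>The derivative is a polynomial in \<open>inverse\<close> itself, so each order of
  smoothness yields the next.\<close>

lemma smooth_on_inverse: "smooth_on (- {0}) (inverse :: real \<Rightarrow> real)"
  unfolding smooth_on_def
proof
  have op: "open (- {0::real})" by auto
  fix k show "Ck_on k (- {0}) (inverse :: real \<Rightarrow> real)"
  proof (induction k)
    case 0
    show ?case by (auto intro!: continuous_intros)
  next
    case (Suc k)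
    show ?case
    proof (rule Ck_on_SucI[OF op])
      show "((inverse :: real \<Rightarrow> real) has_derivative (\<lambda>h. - (inverse x * h * inverse x))) (at x)"
        if "x \<in> - {0}" for x :: real
        using that has_derivative_inverse' by auto
      have "Ck_on k (- {0}) (\<lambda>x::real. - (inverse x * v * inverse x))" for v
        using Ck_on_linear_comp[OF op bounded_linear_minus[OF bounded_linear_ident]
            Ck_on_bilinear[OF op bounded_bilinear_mult
              Ck_on_bilinear[OF op bounded_bilinear_mult Suc Ck_on_const] Suc]] .
      then show "Ck_on k (- {0}) (\<lambda>x. - (inverse x * v * inverse x))" for v :: real .
    qed
  qed
qed

lemma open_invertible: "open {A :: real^'n^'n. invertible A}"
proof -
  have "{A :: real^'n^'n. invertible A} = det -` (- {0})"
    by (auto simp: invertible_det_nz)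
  moreover have "open (det -` (- {0}) :: (real^'n^'n) set)"
    using smooth_on_imp_continuous_on[OF smooth_on_det]
    by (intro open_vimage) auto
  ultimately show ?thesis by simp
qed

lemma matrix_inv:
  assumes "invertible A"
  shows "A ** matrix_inv A = mat 1" "matrix_inv A ** A = mat 1"
  using someI_ex[OF assms[unfolded invertible_def]] unfolding matrix_inv_def by auto

lemma invertible_matrix_inv: "invertible A \<Longrightarrow> invertible (matrix_inv A)"
  using matrix_inv invertible_def by metis

text \<open>Cramer's rule reduces the claim to smoothness of \<open>det\<close> and of the real
  \<open>inverse\<close>. In it, \<open>?c A k j\<close> is \<open>A\<close> with column
  \<open>k\<close> replaced by \<open>axis j 1\<close>.\<close>

lemma smooth_on_matrix_inv: "smooth_on {A :: real^'n^'n. invertible A} matrix_inv"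
proof -
  let ?G = "{A :: real^'n^'n. invertible A}"
  let ?c = "\<lambda>A::real^'n^'n. \<lambda>k j. (\<chi> i l. if l = k then axis j (1::real) $ i else A $ i $ l) :: real^'n^'n"
  have eq: "(\<chi> k j. det (?c A k j) * inverse (det A)) = matrix_inv A" if "A \<in> ?G" for A
  proof -
    have "det A \<noteq> 0" using that by (simp add: invertible_det_nz)
    have "A *v (matrix_inv A *v axis j 1) = axis j 1" for j
      using that by (simp add: matrix_vector_mul_assoc matrix_inv)
    from cramer[OF \<open>det A \<noteq> 0\<close>, THEN iffD1, OF this]
    have "matrix_inv A $ k $ j = det (?c A k j) / det A" for k j
      by (simp add: matrix_vector_mult_basis column_def vec_eq_iff)
    then show ?thesis by (simp add: vec_eq_iff divide_inverse)
  qed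
  have "smooth_on ?G (\<lambda>A. ?c A k j)" for k j
  proof (intro smooth_on_vec_lambda open_invertible)
    show "smooth_on ?G (\<lambda>A. if l = k then axis j (1::real) $ i else A $ i $ l)" for i l
      by (cases "l = k") (auto intro!: smooth_on_const smooth_on_vec_nth smooth_on_ident open_invertible)
  qed
  then have "smooth_on ?G (\<lambda>A. det (?c A k j))" for k j
    using smooth_on_compose[OF open_invertible open_UNIV smooth_on_det] by blast
  moreover have "smooth_on ?G (\<lambda>A. inverse (det A))"
    by (rule smooth_on_compose[OF open_invertible _ smooth_on_inverse])
       (auto simp: invertible_det_nz intro: smooth_on_subset[OF smooth_on_det])
  ultimately have "smooth_on ?G (\<lambda>A. (\<chi> k j. det (?c A k j) * inverse (det A)))"
    by (intro smooth_on_vec_lambda open_invertible smooth_on_bilinear[OF _ bounded_bilinear_mult])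
  then show ?thesis
    by (rule smooth_on_cong[OF open_invertible, rotated]) (use eq in blast)
qed

lemma smooth_on_matrix_inv_comp:
  fixes f :: "'a::real_normed_vector \<Rightarrow> real^'n^'n"
  assumes "open S" "smooth_on S f" "\<And>x. x \<in> S \<Longrightarrow> invertible (f x)"
  shows "smooth_on S (\<lambda>x. matrix_inv (f x))"
  by (rule smooth_on_compose[OF assms(1) open_invertible smooth_on_matrix_inv assms(2)]) (use assms(3) in auto)

lemma smooth_on_jacobian:
  fixes f :: "real^'m \<Rightarrow> real^'n"
  assumes "open S" "smooth_on S f"
  shows "smooth_on S (\<lambda>x. matrix (frechet_derivative f (at x)))"
  unfolding matrix_def
  by (intro smooth_on_vec_lambda smooth_on_vec_nth smooth_on_frechet_derivative[OF _ assms]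
      smooth_on_ident smooth_on_const assms)

lemma smooth_on_jacobian_has_derivative:
  fixes f :: "real^'m \<Rightarrow> real^'n"
  assumes "smooth_on S f" "x \<in> S"
  shows "(f has_derivative (*v) (matrix (frechet_derivative f (at x)))) (at x)"
  using smooth_on_has_derivative[OF assms] smooth_on_linear_frechet_derivative[OF assms]
  by (metis (no_types, lifting) ext matrix_works linear_matrix_vector_mul_eq)

text \<open>Invariance of domain makes the image open, and the inverse is continuous. The derivative
  of the inverse at \<open>y\<close> is the inverse of the Jacobian at \<open>?g y\<close>, so
  differentiability of one order for \<open>?g\<close> gives the next order.\<close>

lemma diffeo_onto_image:
  fixes f :: "real^'n \<Rightarrow> real^'n"
  assumes "open S" "smooth_on S f" "inj_on f S"
    and inv: "\<And>x. x \<in> S \<Longrightarrow> invertible (matrix (frechet_derivative f (at x)))"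
  shows "diffeo S (f ` S) f"
proof -
  let ?g = "inv_into S f" and ?J = "\<lambda>x. matrix (frechet_derivative f (at x))"
  have opf: "open (f ` S)"
    using invariance_of_domain[OF smooth_on_imp_continuous_on[OF assms(2)] assms(1,3)] .
  have contg: "continuous_on (f ` S) ?g"
    by (rule continuous_on_inverse_open)
       (use assms smooth_on_imp_continuous_on in auto)
  have der: "(?g has_derivative (*v) (matrix_inv (?J (?g y)))) (at y)" if "y \<in> f ` S" for y
  proof -
    have x: "?g y \<in> S" "f (?g y) = y"
      using that by (auto simp: inv_into_into f_inv_into_f)
    have "(?g has_derivative (*v) (matrix_inv (?J (?g y)))) (at (f (?g y)))"
    proof (rule has_derivative_inverse_dieudonne[OF assms(1) opf _ contg _ x(1)])
      show "(f has_derivative (*v) (?J (?g y))) (at (?g y))"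
        by (rule smooth_on_jacobian_has_derivative[OF assms(2) x(1)])
      show "(*v) (matrix_inv (?J (?g y))) \<circ> (*v) (?J (?g y)) = id"
        by (auto simp: matrix_vector_mul_assoc matrix_inv[OF inv[OF x(1)]])
    qed (use assms smooth_on_imp_continuous_on in auto)
    then show ?thesis using x by simp
  qed
  have sm: "smooth_on S (\<lambda>x. matrix_inv (?J x))"
    by (rule smooth_on_matrix_inv_comp[OF assms(1) smooth_on_jacobian[OF assms(1,2)] inv])
  have "Ck_on k (f ` S) ?g" for k
  proof (induction k)
    case 0
    show ?case using contg by simp
  next
    case (Suc k)
    show ?case
    proof (rule Ck_on_SucI[OF opf der])
      fix v
      have "Ck_on k (f ` S) (\<lambda>y. matrix_inv (?J (?g y)))"
        using Ck_on_compose[OF opf assms(1) sm[unfolded smooth_on_def, rule_format] Suc]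
        by (auto simp: inv_into_into)
      then show "Ck_on k (f ` S) (\<lambda>y. matrix_inv (?J (?g y)) *v v)"
        by (rule Ck_on_bilinear[OF opf bounded_bilinear_matrix_vector_mult _ Ck_on_const])
    qed
  qed
  then show ?thesis
    using assms opf by (auto simp: diffeo_def smooth_on_def inj_on_imp_bij_betw)
qed

lemma diffeo_jacobian_inv_into:
  fixes f :: "real^'n \<Rightarrow> real^'n"
  assumes "diffeo S T f" "x \<in> S"
  shows "matrix (frechet_derivative (inv_into S f) (at (f x))) ** matrix (frechet_derivative f (at x)) = mat 1"
proof -
  let ?g = "inv_into S f"
  have S: "open S" "smooth_on S f" "smooth_on T ?g" "f x \<in> T" "inj_on f S"
    using assms by (auto simp: diffeo_def bij_betw_def)
  have "((\<lambda>z. ?g (f z)) has_derivative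
      (\<lambda>v. frechet_derivative ?g (at (f x)) (frechet_derivative f (at x) v))) (at x)"
    using has_derivative_compose[OF smooth_on_has_derivative[OF S(2) assms(2)]
        smooth_on_has_derivative[OF S(3,4)]] .
  then have "((\<lambda>z. z) has_derivative
      (\<lambda>v. frechet_derivative ?g (at (f x)) (frechet_derivative f (at x) v))) (at x)"
    by (rule has_derivative_transform_within_open[OF _ S(1) assms(2)]) (use S(5) in auto)
  then have "frechet_derivative ?g (at (f x)) \<circ> frechet_derivative f (at x) = id"
    using has_derivative_unique[OF _ has_derivative_ident] by (auto simp: fun_eq_iff)
  then show "matrix (frechet_derivative ?g (at (f x))) ** matrix (frechet_derivative f (at x)) = mat 1"
    using matrix_compose[OF smooth_on_linear_frechet_derivative[OF S(2) assms(2)]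
        smooth_on_linear_frechet_derivative[OF S(3,4)]] by (simp add: matrix_id_mat_1)
qed

lemma diffeo_invertible_jacobian:
  fixes f :: "real^'n \<Rightarrow> real^'n"
  assumes "diffeo S T f" "x \<in> S"
  shows "invertible (matrix (frechet_derivative f (at x)))"
  using diffeo_jacobian_inv_into[OF assms] invertible_left_inverse by blast

lemma diffeo_inv_into_has_derivative:
  fixes f :: "real^'n \<Rightarrow> real^'n"
  assumes "diffeo S T f" "x \<in> S"
  shows "(inv_into S f has_derivative (*v) (matrix_inv (matrix (frechet_derivative f (at x))))) (at (f x))"
proof -
  let ?J = "matrix (frechet_derivative f (at x))"
    and ?K = "matrix (frechet_derivative (inv_into S f) (at (f x)))"
  have "?K = ?K ** (?J ** matrix_inv ?J)"
    by (simp add: matrix_inv[OF diffeo_invertible_jacobian[OF assms]])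
  then have "?K = matrix_inv ?J"
    by (simp add: matrix_mul_assoc diffeo_jacobian_inv_into[OF assms])
  moreover have "smooth_on T (inv_into S f)" "f x \<in> T"
    using assms by (auto simp: diffeo_def bij_betw_def)
  ultimately show ?thesis
    using smooth_on_jacobian_has_derivative by metis
qed

text \<open>The jets in the definitions of integrability and of homogeneity come down to this shape.
  The translation has the identity as derivative and drops out, leaving a quotient of Jacobians. Two
  charts are allowed because integrability supplies one around each point.\<close>

lemma translation_in_charts:
  fixes f g :: "vec3 \<Rightarrow> vec3"
  assumes f: "diffeo S S' f" "x \<in> S" and g: "diffeo T T' g" "y \<in> T"
  shows "(inv_into T g \<circ> translation (g y - f x) \<circ> f) x = y"
    and "((inv_into T g \<circ> translation (g y - f x) \<circ> f) has_derivative
      (*v) (matrix_inv (matrix (frechet_derivative g (at y))) ** matrix (frechet_derivative f (at x)))) (at x)"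
proof -
  show "(inv_into T g \<circ> translation (g y - f x) \<circ> f) x = y"
    using g by (simp add: translation_def diffeo_def bij_betw_def)
  have "(f has_derivative (*v) (matrix (frechet_derivative f (at x)))) (at x)"
    using f smooth_on_jacobian_has_derivative by (auto simp: diffeo_def)
  then have "((\<lambda>z. f z + (g y - f x)) has_derivative (*v) (matrix (frechet_derivative f (at x)))) (at x)"
    by (auto intro!: derivative_eq_intros)
  then have "((\<lambda>z. inv_into T g (f z + (g y - f x))) has_derivative
      (\<lambda>v. matrix_inv (matrix (frechet_derivative g (at y))) *v (matrix (frechet_derivative f (at x)) *v v))) (at x)"
    by (rule has_derivative_compose) (use diffeo_inv_into_has_derivative[OF g] in simp)
  then show "((inv_into T g \<circ> translation (g y - f x) \<circ> f) has_derivative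
      (*v) (matrix_inv (matrix (frechet_derivative g (at y))) ** matrix (frechet_derivative f (at x)))) (at x)"
    by (simp add: o_def translation_def matrix_vector_mul_assoc)
qed

text \<open>Affine maps realise every invertible matrix as a Jacobian between prescribed points;
  this is why frames and 1-jets amount to points with arbitrary invertible matrices.\<close>

lemma local_diffeo_affine:
  fixes x y :: "real^'n"
  assumes "open U" "open U'" "x \<in> U" "y \<in> U'" "invertible M"
  shows "local_diffeo U U' (\<lambda>z. y + M *v (z - x)) x"
    and "((\<lambda>z. y + M *v (z - x)) has_derivative (*v) M) (at z)"
    and "frechet_derivative (\<lambda>z. y + M *v (z - x)) (at z) = (*v) M"
proof -
  let ?f = "\<lambda>z. y + M *v (z - x)"
  show der: "(?f has_derivative (*v) M) (at z)" for z
    by (auto intro!: derivative_eq_intros bounded_linear.has_derivative[OF matrix_vector_mul_bounded_linear])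
  then show fr: "frechet_derivative ?f (at z) = (*v) M" for z
    using frechet_derivative_at by metis
  have sm: "smooth_on UNIV ?f"
    by (intro smooth_on_add smooth_on_linear_comp[OF _ matrix_vector_mul_bounded_linear]
        smooth_on_diff smooth_on_const smooth_on_ident open_UNIV)
  let ?V = "U \<inter> ?f -` U'"
  have "open ?V"
    using assms(1,2) smooth_on_imp_continuous_on[OF sm] by (intro open_Int open_vimage) auto
  moreover have "inj_on ?f ?V"
  proof (rule inj_onI)
    fix z w assume "?f z = ?f w"
    then have "z - x = w - x"
      using injD[OF inj_matrix_vector_mult[OF assms(5)], of "z - x" "w - x"] by simp
    then show "z = w" by simp
  qed
  ultimately have "diffeo ?V (?f ` ?V) ?f"
    by (intro diffeo_onto_image smooth_on_subset[OF sm]) (auto simp: fr assms(5))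
  then show "local_diffeo U U' ?f x"
    unfolding local_diffeo_def using assms(3,4) by (intro exI[of _ ?V] exI[of _ "?f ` ?V"]) auto
qed

section \<open>Frames and 1-jets as points with invertible matrices\<close>

lemma frame_bundle_eq: "frame_bundle U = U \<times> {A. invertible A}"
proof (intro set_eqI iffI)
  fix X assume "X \<in> frame_bundle U"
  then show "X \<in> U \<times> {A. invertible A}"
    by (auto simp: frame_bundle_def frame_of_def local_diffeo_def jacobian_at_def
        intro: diffeo_invertible_jacobian)
next
  fix X :: frame assume X: "X \<in> U \<times> {A. invertible A}"
  let ?f = "\<lambda>z. fst X + snd X *v (z - 0)"
  have "local_diffeo UNIV UNIV ?f 0"
    by (rule local_diffeo_affine) (use X in auto)
  moreover have "frame_of ?f = X"
    using local_diffeo_affine(3)[of UNIV UNIV 0 "fst X" "snd X" 0] X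
    by (simp add: frame_of_def jacobian_at_def mem_Times_iff)
  ultimately show "X \<in> frame_bundle U"
    unfolding frame_bundle_def using X by (auto intro!: exI[of _ ?f] simp: mem_Times_iff)
qed

lemma open_frame_bundle: "open U \<Longrightarrow> open (frame_bundle U)"
  by (simp add: frame_bundle_eq open_Times open_invertible)

lemma Pi1_iff:
  assumes "open U"
  shows "(x, y, M) \<in> Pi1 U \<longleftrightarrow> x \<in> U \<and> y \<in> U \<and> invertible M"
proof
  assume "(x, y, M) \<in> Pi1 U"
  then show "x \<in> U \<and> y \<in> U \<and> invertible M"
    using diffeo_invertible_jacobian bij_betwE
    unfolding Pi1_def pjet_of_def local_diffeo_def jacobian_at_def diffeo_def by blast
next
  assume *: "x \<in> U \<and> y \<in> U \<and> invertible M"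
  then have "local_diffeo U U (\<lambda>z. y + M *v (z - x)) x"
    by (intro local_diffeo_affine assms) auto
  moreover have "pjet_of (\<lambda>z. y + M *v (z - x)) x = (x, y, M)"
    using * local_diffeo_affine(3)[OF assms assms, of x y M x] by (simp add: pjet_of_def jacobian_at_def)
  ultimately show "(x, y, M) \<in> Pi1 U"
    unfolding Pi1_def by force
qed

section \<open>Lipschitz and Gronwall estimates\<close>

lemma C1_locally_lipschitz:
  fixes f :: "'a::euclidean_space \<Rightarrow> 'b::real_normed_vector"
  assumes "Ck_on 1 S f" "open S" "x \<in> S"
  obtains r C where "r > 0" "cball x r \<subseteq> S" "C \<ge> 0"
    "\<And>y z. y \<in> cball x r \<Longrightarrow> z \<in> cball x r \<Longrightarrow> norm (f y - f z) \<le> C * norm (y - z)"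
proof -
  obtain r where r: "r > 0" "cball x r \<subseteq> S"
    using assms(2,3) open_contains_cball by blast
  let ?D = "\<lambda>y. frechet_derivative f (at y)"
  have C1: "Ck_on (Suc 0) S f" using assms(1) by simp
  \<comment> \<open>Only fixed directional derivatives are known to be continuous. Each is bounded
    on the compact ball, and the sum of these bounds over \<open>Basis\<close> bounds the operator
    norm.\<close>
  have "continuous_on S (\<lambda>y. ?D y b)" for b using C1 by auto
  then have "bounded ((\<lambda>y. ?D y b) ` cball x r)" for b
    using compact_continuous_image[of "cball x r" "\<lambda>y. ?D y b"] r(2) continuous_on_subset
    by (blast intro: compact_imp_bounded compact_cball)
  then have "\<exists>K. \<forall>y\<in>cball x r. norm (?D y b) \<le> K" for b
    unfolding bounded_iff by blast
  then obtain K where K: "\<And>b y. y \<in> cball x r \<Longrightarrow> norm (?D y b) \<le> K b" by metis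
  define C where "C = (\<Sum>b\<in>Basis. K b)"
  have K0: "K b \<ge> 0" for b
    using K[of x b] r(1) norm_ge_zero[of "?D x b"] by (simp del: norm_ge_zero)
  have on: "onorm (?D y) \<le> C" if "y \<in> cball x r" for y
  proof (rule onorm_bound)
    show "0 \<le> C" unfolding C_def by (intro sum_nonneg K0)
    have lin: "linear (?D y)"
      using Ck_on_Suc_has_derivative[OF C1, of y] that r(2) has_derivative_linear by blast
    fix v
    have "norm (?D y v) \<le> (\<Sum>b\<in>Basis. norm ((v \<bullet> b) *\<^sub>R ?D y b))"
      by (subst linear_sum_Basis[OF lin]) (rule norm_sum)
    also have "\<dots> \<le> (\<Sum>b\<in>Basis. norm v * K b)"
      by (intro sum_mono) (auto intro!: mult_mono Basis_le_norm K that)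
    finally show "norm (?D y v) \<le> C * norm v"
      by (simp add: C_def sum_distrib_left sum_distrib_right mult.commute)
  qed
  show ?thesis
  proof
    show "C \<ge> 0" unfolding C_def by (intro sum_nonneg K0)
    show "norm (f y - f z) \<le> C * norm (y - z)" if "y \<in> cball x r" "z \<in> cball x r" for y z
    proof (rule differentiable_bound[OF convex_cball _ on that])
      show "(f has_derivative ?D w) (at w within cball x r)" if "w \<in> cball x r" for w
        using Ck_on_Suc_has_derivative[OF C1, of w] that r(2) has_derivative_at_withinI by blast
    qed
  qed (use r in auto)
qed

text \<open>The derivative of the squared norm of \<open>u\<close> is at most \<open>2 * C\<close>
  times that square, so the weight \<open>exp (- 2 * C * t)\<close> makes the product nonincreasing.
  The square is used because the norm itself need not be differentiable where \<open>u\<close>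
  vanishes.\<close>

lemma gronwall_zero:
  fixes u :: "real \<Rightarrow> 'a::real_inner"
  assumes "\<And>t. 0 \<le> t \<Longrightarrow> t \<le> T \<Longrightarrow> (u has_vector_derivative u' t) (at t)"
    and "\<And>t. 0 \<le> t \<Longrightarrow> t \<le> T \<Longrightarrow> norm (u' t) \<le> C * norm (u t)"
    and "u 0 = 0" "0 \<le> T"
  shows "u T = 0"
proof -
  let ?f = "\<lambda>t. exp (- 2 * C * t) * (u t \<bullet> u t)"
  have "?f T \<le> ?f 0"
  proof (rule DERIV_nonpos_imp_nonincreasing[OF \<open>0 \<le> T\<close>])
    fix t assume t: "0 \<le> t" "t \<le> T"
    have "((\<lambda>t. u t \<bullet> u t) has_derivative (\<lambda>h. u t \<bullet> (h *\<^sub>R u' t) + (h *\<^sub>R u' t) \<bullet> u t)) (at t)"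
      using assms(1)[OF t] unfolding has_vector_derivative_def
      by (intro has_derivative_inner)
    then have "((\<lambda>t. u t \<bullet> u t) has_real_derivative 2 * (u t \<bullet> u' t)) (at t)"
      by (rule has_derivative_imp_has_field_derivative) (simp add: inner_commute)
    then have "(?f has_real_derivative
        exp (- 2 * C * t) * (2 * (u t \<bullet> u' t)) + (- 2 * C * exp (- 2 * C * t)) * (u t \<bullet> u t)) (at t)"
      by (auto intro!: derivative_eq_intros)
    moreover have "exp (- 2 * C * t) * (2 * (u t \<bullet> u' t)) + (- 2 * C * exp (- 2 * C * t)) * (u t \<bullet> u t) \<le> 0"
    proof -
      have "u t \<bullet> u' t \<le> norm (u t) * norm (u' t)" by (rule norm_cauchy_schwarz)
      also have "\<dots> \<le> norm (u t) * (C * norm (u t))"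
        using assms(2)[OF t] by (intro mult_left_mono) auto
      also have "\<dots> = C * (u t \<bullet> u t)" by (simp add: dot_square_norm power2_eq_square)
      finally have "exp (- 2 * C * t) * (u t \<bullet> u' t - C * (u t \<bullet> u t)) \<le> 0"
        by (intro mult_nonneg_nonpos) auto
      then show ?thesis by (simp add: algebra_simps)
    qed
    ultimately show "\<exists>y. (?f has_real_derivative y) (at t) \<and> y \<le> 0" by blast
  qed
  then have "u T \<bullet> u T \<le> 0" using assms(3) by (simp add: mult_le_0_iff)
  then show ?thesis by (metis inner_eq_zero_iff inner_ge_zero order_antisym)
qed


section \<open>Coordinates of non-holonomic jets\<close>

text \<open>The orbit with coordinates \<open>(x, y, P, D, T)\<close> is that of the 1-jet at \<open>(x, mat 1)\<close> of any
  \<open>(z, A) \<mapsto> (\<psi> z, p z ** A)\<close> with \<open>\<psi> x = y\<close>, \<open>p x = P\<close>, \<open>D\<psi>(x) = D\<close> and \<open>Dp(x) v = dir_coeff T v\<close>.\<close>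

definition dir_coeff :: "mat3^3 \<Rightarrow> vec3 \<Rightarrow> mat3" where
  "dir_coeff T v = (\<Sum>k\<in>UNIV. v $ k *\<^sub>R T $ k)"

text \<open>The derivative at the frame \<open>(x, A)\<close>, by the product rule. It depends on
  \<open>A\<close> because an orbit collects the jets at all frames over \<open>x\<close>.\<close>

definition jet_map :: "mat3 \<Rightarrow> mat3 \<Rightarrow> mat3^3 \<Rightarrow> mat3 \<Rightarrow> frame \<Rightarrow> frame" where
  "jet_map P D T A w = (D *v fst w, dir_coeff T (fst w) ** A + P ** snd w)"

definition jet :: "nhcoord \<Rightarrow> nhjet" where
  "jet = (\<lambda>(x, y, P, D, T). {((x, A), (y, P ** A), jet_map P D T A) | A. invertible A})"

definition jet_coeff :: "nhcoord \<Rightarrow> mat3" where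
  "jet_coeff c = fst (snd (snd c))"

text \<open>The last component is the product rule for
  \<open>z \<mapsto> p' (\<psi> z) ** p z\<close>. The formula describes a composite only for
  matching base points; discarding \<open>y'\<close> makes it a smooth map on all pairs of
  coordinates.\<close>

definition comp_coords :: "nhcoord \<Rightarrow> nhcoord \<Rightarrow> nhcoord" where
  "comp_coords = (\<lambda>(y, z, P', D', T') (x, y', P, D, T).
     (x, z, P' ** P, D' ** D,
      \<chi> k. dir_coeff T' (D *v axis k 1) ** P + P' ** dir_coeff T (axis k 1)))"

lemma invertible_mat1: "invertible (mat 1 :: real^'n^'n)"
  unfolding invertible_def by (intro exI[of _ "mat 1"]) simp

lemma linear_dir_coeff: "linear (dir_coeff T)"
  unfolding dir_coeff_def
  by (auto intro!: linearI simp: algebra_simps sum.distrib scaleR_sum_right)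

lemma dir_coeff_axis: "dir_coeff T (axis k 1) = T $ k"
proof -
  have "dir_coeff T (axis k 1) = (\<Sum>j\<in>UNIV. if j = k then T $ j else 0)"
    unfolding dir_coeff_def by (rule sum.cong) (auto simp: axis_def)
  then show ?thesis by simp
qed

lemma linear_eq_on_axis:
  fixes f g :: "real^'n \<Rightarrow> 'b::real_vector"
  assumes "linear f" "linear g" "\<And>k. f (axis k 1) = g (axis k 1)"
  shows "f = g"
  by (rule linear_eq_stdbasis[OF assms(1,2)]) (auto simp: Basis_vec_def assms(3))

lemma dir_coeff_linear: "linear P' \<Longrightarrow> dir_coeff (\<chi> k. P' (axis k 1)) = P'"
  by (rule linear_eq_on_axis[OF linear_dir_coeff]) (simp_all add: dir_coeff_axis)

lemma has_derivative_product_form: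
  fixes \<Psi> :: "frame \<Rightarrow> frame"
  assumes "open V" "x \<in> V" "invertible A"
    and \<Psi>: "\<And>X. fst X \<in> V \<Longrightarrow> invertible (snd X) \<Longrightarrow> \<Psi> X = (\<psi> (fst X), P (fst X) ** snd X)"
    and \<psi>: "(\<psi> has_derivative \<psi>') (at x)" and P: "(P has_derivative P') (at x)"
  shows "(\<Psi> has_derivative (\<lambda>w. (\<psi>' (fst w), P x ** snd w + P' (fst w) ** A))) (at (x, A))"
proof -
  have 1: "((\<lambda>X::frame. \<psi> (fst X)) has_derivative (\<lambda>w. \<psi>' (fst w))) (at (x, A))"
    by (rule has_derivative_compose[where f = fst and g = \<psi>, OF
          bounded_linear_imp_has_derivative[OF bounded_linear_fst]]) (use \<psi> in simp)
  have 2: "((\<lambda>X::frame. P (fst X)) has_derivative (\<lambda>w. P' (fst w))) (at (x, A))"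
    by (rule has_derivative_compose[where f = fst and g = P, OF
          bounded_linear_imp_has_derivative[OF bounded_linear_fst]]) (use P in simp)
  have "((\<lambda>X::frame. (\<psi> (fst X), P (fst X) ** snd X)) has_derivative
      (\<lambda>w. (\<psi>' (fst w), P (fst (x, A)) ** snd w + P' (fst w) ** snd (x, A)))) (at (x, A))"
    by (intro has_derivative_Pair 1 bounded_bilinear.FDERIV[OF bounded_bilinear_matrix_mult 2]
        bounded_linear_imp_has_derivative[OF bounded_linear_snd])
  moreover have "open (frame_bundle V)" "(x, A) \<in> frame_bundle V"
    using open_frame_bundle[OF assms(1)] assms(2,3) by (auto simp: frame_bundle_eq)
  ultimately have "(\<Psi> has_derivative
      (\<lambda>w. (\<psi>' (fst w), P (fst (x, A)) ** snd w + P' (fst w) ** snd (x, A)))) (at (x, A))"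
    by (rule has_derivative_transform_within_open) (use \<Psi> in \<open>auto simp: frame_bundle_eq\<close>)
  then show ?thesis by simp
qed

text \<open>A product form near \<open>x\<close> yields the derivative at every frame over
  \<open>x\<close> at once, hence the whole orbit. Units, elements of \<open>J1\<close>,
  prolongations and homogeneity jets all receive their coordinates this way.\<close>

lemma nhjet_of_product_form:
  assumes "open V" "x \<in> V"
    and \<Psi>: "\<And>X. fst X \<in> V \<Longrightarrow> invertible (snd X) \<Longrightarrow> \<Psi> X = (\<psi> (fst X), P (fst X) ** snd X)"
    and \<psi>: "(\<psi> has_derivative \<psi>') (at x)" and P: "(P has_derivative P') (at x)"
  shows "nhjet_of \<Psi> x = jet (x, \<psi> x, P x, matrix \<psi>', \<chi> k. P' (axis k 1))"
proof -
  have lin: "linear \<psi>'" "linear P'"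
    using \<psi> P has_derivative_linear by auto
  have "frechet_derivative \<Psi> (at (x, A)) = jet_map (P x) (matrix \<psi>') (\<chi> k. P' (axis k 1)) A"
    if "invertible A" for A
    using frechet_derivative_at[OF has_derivative_product_form[OF assms(1,2) that \<Psi> \<psi> P], symmetric]
    by (simp add: jet_map_def fun_eq_iff dir_coeff_linear[OF lin(2)]
        matrix_works[OF linear_matrix_vector_mul_eq[THEN iffD2, OF lin(1)]] add.commute)
  then have *: "fjet_of \<Psi> (x, A) =
      ((x, A), (\<psi> x, P x ** A), jet_map (P x) (matrix \<psi>') (\<chi> k. P' (axis k 1)) A)"
    if "invertible A" for A
    using \<Psi>[of "(x, A)"] assms(2) that by (simp add: fjet_of_def)
  have "nhjet_of \<Psi> x = (\<lambda>A. fjet_of \<Psi> (x, A)) ` {A. invertible A}"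
    by (auto simp: nhjet_of_def frame_bundle_eq)
  also have "\<dots> = (\<lambda>A. ((x, A), (\<psi> x, P x ** A), jet_map (P x) (matrix \<psi>') (\<chi> k. P' (axis k 1)) A)) `
      {A. invertible A}"
    by (rule image_cong) (use * in auto)
  finally show ?thesis
    by (auto simp: jet_def)
qed

lemma unit_rep_jet: "unit_rep (jet (x, y, P, D, T)) = ((x, mat 1), (y, P), jet_map P D T (mat 1))"
  unfolding unit_rep_def
  by (rule the_equality) (auto simp: jet_def invertible_mat1)

lemma coords_jet: "coords (jet c) = c"
proof -
  obtain x y P D T where c: "c = (x, y, P, D, T)" by (cases c)
  have "matrix ((*v) D) = D" by simp
  then show ?thesis
    by (simp add: c coords_def unit_rep_jet jet_map_def dir_coeff_axis
        linear_0[OF linear_dir_coeff] vec_eq_iff)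
qed

lemma source_jet: "source (jet c) = fst c"
  by (cases c) (simp add: source_def unit_rep_jet)

lemma target_jet: "target (jet c) = fst (snd c)"
  by (cases c) (simp add: target_def unit_rep_jet)

lemma nhunit_eq: "nhunit x = jet (x, x, mat 1, mat 1, 0)"
proof -
  have "nhjet_of id x = jet (x, x, mat 1, matrix id, \<chi> k. 0)"
    by (rule nhjet_of_product_form[where V = UNIV and \<psi> = "\<lambda>x. x"])
       (auto simp: id_def intro!: derivative_eq_intros)
  then show ?thesis
    by (simp add: nhunit_def matrix_id_mat_1 zero_vec_def)
qed

lemma jet_map_comp:
  "jet_map P' D' T' (P ** A) \<circ> jet_map P D T A =
   jet_map (P' ** P) (D' ** D)
     (\<chi> k. dir_coeff T' (D *v axis k 1) ** P + P' ** dir_coeff T (axis k 1)) A"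
proof -
  have "linear (\<lambda>v. dir_coeff T' (D *v v) ** P + P' ** dir_coeff T v)"
    by (auto intro!: linearI simp: linear_add[OF linear_dir_coeff] linear_cmul[OF linear_dir_coeff]
        matrix_vector_right_distrib matrix_vector_mult_scaleR matrix_add_ldistrib bounded_bilinear.add_left[OF bounded_bilinear_matrix_mult]
        scaleR_add_right scalar_matrix_assoc[symmetric]
        bounded_bilinear.scaleR_right[OF bounded_bilinear_matrix_mult])
  from dir_coeff_linear[OF this] show ?thesis
    by (simp add: jet_map_def fun_eq_iff matrix_vector_mul_assoc matrix_mul_assoc
        matrix_add_ldistrib bounded_bilinear.add_left[OF bounded_bilinear_matrix_mult] add.assoc)
qed

text \<open>The representative of \<open>p\<close> at the frame \<open>A\<close> has to be matched
  with that of \<open>q\<close> at \<open>P ** A\<close>; invertibility of \<open>P\<close> ensures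
  that the latter exists.\<close>

lemma nhcomp_jet:
  assumes "fst q = fst (snd p)" "invertible (jet_coeff p)"
  shows "jet q \<odot> jet p = jet (comp_coords q p)"
proof -
  obtain x y P D T where p: "p = (x, y, P, D, T)" by (cases p)
  obtain z P' D' T' where q: "q = (y, z, P', D', T')" using assms(1) p by (cases q) auto
  have "invertible (P ** A)" if "invertible A" for A
    using assms(2) that invertible_mult by (simp add: p jet_coeff_def)
  then show ?thesis
    unfolding nhcomp_def jet_def comp_coords_def p q prod.case jet_map_comp[symmetric]
    by (auto simp: matrix_mul_assoc)
qed

text \<open>Characterising the inverse by two products avoids an explicit formula for its
  coordinates. For prolongations both products are evaluated by the cocycle property.\<close>

lemma nhinv_jet:
  assumes "fst q = fst (snd p)" "fst (snd q) = fst p"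
    and qp: "comp_coords q p = (fst p, fst p, mat 1, mat 1, 0)"
    and pq: "comp_coords p q = (fst q, fst q, mat 1, mat 1, 0)"
  shows "nhinv (jet p) = jet q"
proof -
  obtain x y P D T where p: "p = (x, y, P, D, T)" by (cases p)
  obtain P' D' T' where q: "q = (y, x, P', D', T')" using assms(1,2) p by (cases q) auto
  have 1: "jet_map (mat 1) (mat 1) 0 A = id" for A
    by (simp add: jet_map_def fun_eq_iff dir_coeff_def)
  have PP: "P' ** P = mat 1" "P ** P' = mat 1"
    using qp pq by (simp_all add: p q comp_coords_def)
  then have inv: "invertible P" "invertible P'" unfolding invertible_def by blast+
  have "jet_map P' D' T' (P ** A) \<circ> jet_map P D T A = id" for A
    unfolding jet_map_comp using qp 1[of A] by (simp add: p q comp_coords_def)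
  moreover have "jet_map P D T A \<circ> jet_map P' D' T' (P ** A) = id" for A
    using jet_map_comp[of P D T P' "P ** A" D' T'] pq 1[of "P ** A"]
    by (simp add: p q comp_coords_def matrix_mul_assoc PP)
  ultimately have i: "inv (jet_map P D T A) = jet_map P' D' T' (P ** A)" for A
    by (rule inv_unique_comp[rotated])
  show ?thesis
  proof (intro set_eqI iffI)
    fix t assume "t \<in> nhinv (jet p)"
    then obtain A where "invertible A" "t = ((y, P ** A), (x, A), jet_map P' D' T' (P ** A))"
      by (auto simp: nhinv_def jet_def p i)
    then show "t \<in> jet q"
      using inv by (auto simp: q jet_def invertible_mult matrix_mul_assoc PP intro!: exI[of _ "P ** A"])
  next
    fix t assume "t \<in> jet q"
    then obtain A where A: "invertible A" "t = ((y, A), (x, P' ** A), jet_map P' D' T' A)"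
      by (auto simp: jet_def q)
    have "inv (jet_map P D T (P' ** A)) = jet_map P' D' T' A"
      using i[of "P' ** A"] by (simp add: matrix_mul_assoc PP)
    then show "t \<in> nhinv (jet p)"
      using A inv by (auto simp: nhinv_def jet_def p invertible_mult matrix_mul_assoc PP
          intro!: exI[of _ "P' ** A"])
  qed
qed

text \<open>Each frame over a point is the unit frame acted on by its own matrix, so equivariance
  reduces a map to its values on unit frames.\<close>

lemma equivariant_product_form:
  assumes "equivariant_on V \<Psi>" "fst X \<in> V" "invertible (snd X)"
  shows "\<Psi> X = (fst (\<Psi> (fst X, mat 1)), snd (\<Psi> (fst X, mat 1)) ** snd X)"
proof -
  have "(fst X, mat 1) \<in> frame_bundle V" using assms(2) by (simp add: frame_bundle_eq invertible_mat1)
  then have "\<Psi> (frame_act (fst X, mat 1) (snd X)) = frame_act (\<Psi> (fst X, mat 1)) (snd X)"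
    using assms(1,3) unfolding equivariant_on_def by blast
  then show ?thesis by (simp add: frame_act_def)
qed

lemma smooth_on_unit_slice:
  assumes "open V" "smooth_on (frame_bundle V) \<Psi>"
  shows "smooth_on V (\<lambda>x. fst (\<Psi> (x, mat 1)))" "smooth_on V (\<lambda>x. snd (\<Psi> (x, mat 1)))"
proof -
  have "smooth_on V (\<lambda>x. \<Psi> (x, mat 1))"
    by (rule smooth_on_compose[OF assms(1) open_frame_bundle[OF assms(1)] assms(2)
          smooth_on_Pair[OF assms(1) smooth_on_ident smooth_on_const]])
       (auto simp: assms frame_bundle_eq invertible_mat1)
  then show "smooth_on V (\<lambda>x. fst (\<Psi> (x, mat 1)))" "smooth_on V (\<lambda>x. snd (\<Psi> (x, mat 1)))"
    using assms(1) smooth_on_fst smooth_on_snd by blast+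
qed

text \<open>This makes \<open>coords\<close> injective on \<open>J1 B\<close>, so that membership in
  a subgroupoid can be decided on coordinates. Equivariance provides the product form from which the
  coordinates are read.\<close>

lemma J1_jet:
  assumes "p \<in> J1 B"
  shows "p = jet (coords p)" "invertible (jet_coeff (coords p))"
    "fst (coords p) \<in> B" "fst (snd (coords p)) \<in> B"
    "source p = fst (coords p)" "target p = fst (snd (coords p))"
proof -
  obtain \<Psi> x V V' where p: "p = nhjet_of \<Psi> x" and \<Psi>: "bundle_iso V V' \<Psi>" "V \<subseteq> B" "V' \<subseteq> B" "x \<in> V"
    using assms unfolding J1_def by blast
  have V: "open V" "smooth_on (frame_bundle V) \<Psi>" "equivariant_on V \<Psi>"
      "bij_betw \<Psi> (frame_bundle V) (frame_bundle V')"
    using \<Psi> by (auto simp: bundle_iso_def diffeo_def)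
  let ?\<psi> = "\<lambda>x. fst (\<Psi> (x, mat 1))" and ?P = "\<lambda>x. snd (\<Psi> (x, mat 1))"
  have eq: "p = jet (x, ?\<psi> x, ?P x, matrix (frechet_derivative ?\<psi> (at x)),
      \<chi> k. frechet_derivative ?P (at x) (axis k 1))"
    unfolding p using equivariant_product_form[OF V(3)]
    by (intro nhjet_of_product_form[OF V(1) \<Psi>(4)]
        smooth_on_has_derivative[OF smooth_on_unit_slice(1)[OF V(1,2)] \<Psi>(4)]
        smooth_on_has_derivative[OF smooth_on_unit_slice(2)[OF V(1,2)] \<Psi>(4)])
  show "p = jet (coords p)" by (metis eq coords_jet)
  have "\<Psi> (x, mat 1) \<in> frame_bundle V'"
    using V(4) \<Psi>(4) by (intro bij_betwE[OF V(4), rule_format]) (simp add: frame_bundle_eq invertible_mat1)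
  then show "invertible (jet_coeff (coords p))" "fst (coords p) \<in> B" "fst (snd (coords p)) \<in> B"
    using \<Psi>(2,3,4) by (auto simp: eq coords_jet jet_coeff_def frame_bundle_eq mem_Times_iff)
  show "source p = fst (coords p)" "target p = fst (snd (coords p))"
    by (simp_all add: eq coords_jet source_jet target_jet)
qed

section \<open>Cocycles and the coordinates of prolongations\<close>

definition cocycle_on :: "vec3 set \<Rightarrow> (vec3 \<times> vec3 \<Rightarrow> mat3) \<Rightarrow> bool" where
  "cocycle_on U M \<longleftrightarrow> smooth_on (U \<times> U) M \<and>
     (\<forall>x\<in>U. \<forall>y\<in>U. invertible (M (x, y))) \<and>
     (\<forall>x\<in>U. \<forall>y\<in>U. \<forall>z\<in>U. M (x, z) = M (y, z) ** M (x, y))"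

lemma cocycle_onD:
  assumes "cocycle_on U M"
  shows "smooth_on (U \<times> U) M"
    and "x \<in> U \<Longrightarrow> y \<in> U \<Longrightarrow> invertible (M (x, y))"
    and "x \<in> U \<Longrightarrow> y \<in> U \<Longrightarrow> z \<in> U \<Longrightarrow> M (x, z) = M (y, z) ** M (x, y)"
  using assms unfolding cocycle_on_def by blast+

lemma parallelismD:
  assumes "parallelism U P" "x \<in> U" "y \<in> U"
  shows "P (x, y) \<in> Pi1 U" "psource (P (x, y)) = x" "ptarget (P (x, y)) = y"
    and "z \<in> U \<Longrightarrow> P (x, z) = pcomp (P (y, z)) (P (x, y))"
    and "smooth_on (U \<times> U) P"
  using assms unfolding parallelism_def by blast+

text \<open>\<open>M\<close> and \<open>N\<close> are the matrix parts of \<open>P\<close> and \<open>Q\<close>; the last component is the derivative at \<open>x\<close> of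
  \<open>x' \<mapsto> M (x', \<psi> x')\<close> for any \<open>\<psi>\<close> with \<open>\<psi> x = y\<close> and \<open>D\<psi>(x) = N (x, y)\<close>.\<close>

definition prolong_coords :: "(vec3 \<times> vec3 \<Rightarrow> mat3) \<Rightarrow> (vec3 \<times> vec3 \<Rightarrow> mat3) \<Rightarrow> vec3 \<times> vec3 \<Rightarrow> nhcoord" where
  "prolong_coords M N z = (fst z, snd z, M z, N z,
     \<chi> k. frechet_derivative M (at z) (axis k 1, N z *v axis k 1))"

lemma parallelism_iff_cocycle:
  assumes "open U"
  shows "parallelism U P \<longleftrightarrow>
    cocycle_on U (\<lambda>z. snd (snd (P z))) \<and> (\<forall>x\<in>U. \<forall>y\<in>U. P (x, y) = (x, y, snd (snd (P (x, y)))))"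
    (is "?L \<longleftrightarrow> ?C \<and> ?E")
proof
  assume L: ?L
  have op: "open (U \<times> U)" using assms open_Times by blast
  have E: "P (x, y) = (x, y, snd (snd (P (x, y))))" if "x \<in> U" "y \<in> U" for x y
    using parallelismD(2,3)[OF L that] by (simp add: psource_def ptarget_def prod_eq_iff)
  have "invertible (snd (snd (P (x, y))))" if "x \<in> U" "y \<in> U" for x y
  proof -
    have "P (x, y) \<in> Pi1 U" using parallelismD(1)[OF L that] .
    then have "(x, y, snd (snd (P (x, y)))) \<in> Pi1 U" using E[OF that] by argo
    then show ?thesis using Pi1_iff[OF assms] by blast
  qed
  moreover have "snd (snd (P (x, z))) = snd (snd (P (y, z))) ** snd (snd (P (x, y)))"
    if "x \<in> U" "y \<in> U" "z \<in> U" for x y z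
  proof -
    have "P (x, z) = pcomp (P (y, z)) (P (x, y))" using parallelismD(4)[OF L that] .
    then show ?thesis by (simp add: pcomp_def)
  qed
  moreover have "smooth_on (U \<times> U) (\<lambda>z. snd (snd (P z)))"
    using L unfolding parallelism_def by (intro smooth_on_snd[OF op]) blast
  ultimately have ?C unfolding cocycle_on_def by blast
  with E show "?C \<and> ?E" by blast
next
  assume CE: "?C \<and> ?E"
  then have E: "\<And>x y. x \<in> U \<Longrightarrow> y \<in> U \<Longrightarrow> P (x, y) = (x, y, snd (snd (P (x, y))))" by blast
  have C: ?C using CE by blast
  have op: "open (U \<times> U)" using assms open_Times by blast
  have "smooth_on (U \<times> U) (\<lambda>z. (fst z, snd z, snd (snd (P z))))"
    using cocycle_onD(1)[OF C]
    by (intro smooth_on_Pair[OF op] smooth_on_fst[OF op] smooth_on_snd[OF op smooth_on_ident[OF op]]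
        smooth_on_ident[OF op])
  then have "smooth_on (U \<times> U) P"
    by (rule smooth_on_cong[OF op, rotated]) (use E in force)
  moreover have "P (x, y) \<in> Pi1 U \<and> psource (P (x, y)) = x \<and> ptarget (P (x, y)) = y"
    if "x \<in> U" "y \<in> U" for x y
  proof -
    have "P (x, y) = (x, y, snd (snd (P (x, y))))" using E that by blast
    then obtain A where A: "P (x, y) = (x, y, A)" by blast
    moreover have "invertible (snd (snd (P (x, y))))" using cocycle_onD(2)[OF C that] .
    ultimately show ?thesis
      using that by (simp add: Pi1_iff[OF assms] psource_def ptarget_def)
  qed
  moreover have "P (x, z) = pcomp (P (y, z)) (P (x, y))" if U: "x \<in> U" "y \<in> U" "z \<in> U" for x y z
  proof -
    obtain A1 A2 A3 where "P (x, y) = (x, y, A1)" "P (y, z) = (y, z, A2)" "P (x, z) = (x, z, A3)"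
      using E U by blast
    moreover have "snd (snd (P (x, z))) = snd (snd (P (y, z))) ** snd (snd (P (x, y)))"
      using cocycle_onD(3)[OF C U] .
    ultimately show ?thesis by (simp add: pcomp_def psource_def ptarget_def)
  qed
  ultimately show ?L unfolding parallelism_def by blast
qed

text \<open>On the diagonal the value is idempotent and invertible.\<close>

lemma cocycle_on_diagonal:
  assumes "cocycle_on U M" "x \<in> U"
  shows "M (x, x) = mat 1"
proof -
  have *: "M (x, x) ** M (x, x) = M (x, x)" "invertible (M (x, x))"
    using cocycle_onD(2,3)[OF assms(1)] assms(2) by metis+
  from arg_cong[OF *(1), of "(**) (matrix_inv (M (x, x)))"] show ?thesis
    by (simp only: matrix_mul_assoc matrix_inv(2)[OF *(2)] matrix_mul_lid)
qed

text \<open>Shared by prolongations, where \<open>\<psi>\<close> realises a value of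
  \<open>Q\<close>, and by homogeneity jets, where \<open>\<psi>\<close> is a translation read in a
  chart.\<close>

lemma nhjet_of_prolong:
  assumes "open V" "x \<in> V"
    and \<Psi>: "\<And>X. fst X \<in> V \<Longrightarrow> invertible (snd X) \<Longrightarrow>
      \<Psi> X = (\<psi> (fst X), M (fst X, \<psi> (fst X)) ** snd X)"
    and \<psi>: "(\<psi> has_derivative (*v) (N (x, \<psi> x))) (at x)"
    and M: "(M has_derivative frechet_derivative M (at (x, \<psi> x))) (at (x, \<psi> x))"
  shows "nhjet_of \<Psi> x = jet (prolong_coords M N (x, \<psi> x))"
proof -
  have "((\<lambda>x'. M (x', \<psi> x')) has_derivative
      (\<lambda>v. frechet_derivative M (at (x, \<psi> x)) (v, N (x, \<psi> x) *v v))) (at x)"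
    by (rule has_derivative_compose[OF has_derivative_Pair[OF has_derivative_ident \<psi>] M])
  from nhjet_of_product_form[where P = "\<lambda>x'. M (x', \<psi> x')", OF assms(1,2) \<Psi> \<psi> this]
  show ?thesis by (simp add: prolong_coords_def)
qed

lemma prolongation_eq:
  assumes "open U" "parallelism U P" "parallelism U Q" "x \<in> U" "y \<in> U"
  shows "prolongation U P Q (x, y) =
    jet (prolong_coords (\<lambda>z. snd (snd (P z))) (\<lambda>z. snd (snd (Q z))) (x, y))"
proof -
  let ?M = "\<lambda>z. snd (snd (P z))" and ?N = "\<lambda>z. snd (snd (Q z))"
  have P: "cocycle_on U ?M" "\<And>x y. x \<in> U \<Longrightarrow> y \<in> U \<Longrightarrow> P (x, y) = (x, y, ?M (x, y))"
    and Q: "Q (x, y) = (x, y, ?N (x, y))" "Q (x, y) \<in> Pi1 U"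
    using assms parallelism_iff_cocycle[OF assms(1)] parallelismD(1)[OF assms(3-5)] by blast+
  \<comment> \<open>The choice is arbitrary up to its 1-jet: only \<open>\<psi> x = y\<close> and
    the Jacobian at \<open>x\<close>, both prescribed by \<open>Q (x, y)\<close>, enter the
    coordinates.\<close>
  define \<psi> where "\<psi> = (SOME \<psi>. local_diffeo U U \<psi> x \<and> pjet_of \<psi> x = Q (x, y))"
  have "\<exists>\<psi>. local_diffeo U U \<psi> x \<and> pjet_of \<psi> x = Q (x, y)"
  proof -
    obtain \<psi> x' where "local_diffeo U U \<psi> x'" "Q (x, y) = pjet_of \<psi> x'"
      using Q(2) unfolding Pi1_def by blast
    moreover from this have "x' = x" using Q(1) by (metis fst_conv pjet_of_def)
    ultimately show ?thesis by auto
  qed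
  then have "local_diffeo U U \<psi> x \<and> pjet_of \<psi> x = Q (x, y)"
    unfolding \<psi>_def by (rule someI_ex)
  then obtain V V' where V: "V \<subseteq> U" "V' \<subseteq> U" "x \<in> V" "diffeo V V' \<psi>"
    and jet: "\<psi> x = y" "jacobian_at \<psi> x = ?N (x, y)"
    unfolding local_diffeo_def pjet_of_def by (subst (asm) Q(1)) auto
  then have V': "open V" "smooth_on V \<psi>" "\<And>x. x \<in> V \<Longrightarrow> \<psi> x \<in> U"
    using bij_betwE unfolding diffeo_def by blast+
  have "nhjet_of (\<lambda>X. pjet_frame (P (fst X, \<psi> (fst X))) X) x = jet (prolong_coords ?M ?N (x, \<psi> x))"
  proof (rule nhjet_of_prolong[OF V'(1) V(3)])
    fix X :: frame assume "fst X \<in> V"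
    then have "P (fst X, \<psi> (fst X)) = (fst X, \<psi> (fst X), ?M (fst X, \<psi> (fst X)))"
      using V V' by (intro P) auto
    then have "ptarget (P (fst X, \<psi> (fst X))) = \<psi> (fst X)"
      by (metis fst_conv ptarget_def snd_conv)
    then show "pjet_frame (P (fst X, \<psi> (fst X))) X = (\<psi> (fst X), ?M (fst X, \<psi> (fst X)) ** snd X)"
      by (simp add: pjet_frame_def)
  next
    show "(\<psi> has_derivative (*v) (?N (x, \<psi> x))) (at x)"
      using smooth_on_jacobian_has_derivative[OF V'(2) V(3)] jet by (simp add: jacobian_at_def)
    show "(?M has_derivative frechet_derivative ?M (at (x, \<psi> x))) (at (x, \<psi> x))"
      using P(1) assms(4,5) jet(1) by (intro smooth_on_has_derivative[OF cocycle_onD(1)]) auto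
  qed
  then show ?thesis by (simp add: prolongation_def \<psi>_def[symmetric] jet(1))
qed

lemma smooth_on_prolong_coords:
  assumes "open U" "cocycle_on U M" "cocycle_on U N"
  shows "smooth_on (U \<times> U) (prolong_coords M N)"
proof -
  have op: "open (U \<times> U)" using assms open_Times by blast
  have sm: "smooth_on (U \<times> U) M" "smooth_on (U \<times> U) N" using assms cocycle_onD(1) by blast+
  have id: "smooth_on (U \<times> U) (\<lambda>z. z)" by (rule smooth_on_ident[OF op])
  have "smooth_on (U \<times> U) (\<lambda>z. frechet_derivative M (at z) (axis k 1, N z *v axis k 1))" for k
    by (intro smooth_on_frechet_derivative[OF op op sm(1) id] smooth_on_Pair[OF op] smooth_on_const
        smooth_on_bilinear[OF op bounded_bilinear_matrix_vector_mult] sm)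
  then show ?thesis
    unfolding prolong_coords_def
    by (intro smooth_on_Pair[OF op] smooth_on_fst[OF op] smooth_on_snd[OF op] id sm
        smooth_on_vec_lambda[OF op])
qed

text \<open>Since \<open>N (x, x) = mat 1\<close>, the last coordinate differentiates
  \<open>M\<close> in directions \<open>(v, v)\<close>, along which \<open>M\<close> is constantly
  \<open>mat 1\<close>.\<close>

lemma prolong_coords_diagonal:
  assumes "open U" "cocycle_on U M" "cocycle_on U N" "x \<in> U"
  shows "prolong_coords M N (x, x) = (x, x, mat 1, mat 1, 0)"
proof -
  have M: "(M has_derivative frechet_derivative M (at (x, x))) (at (x, x))"
    using assms by (intro smooth_on_has_derivative[OF cocycle_onD(1)]) auto
  have "((\<lambda>y. M (y, y)) has_derivative (\<lambda>v. frechet_derivative M (at (x, x)) (v, v))) (at x)"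
    by (rule has_derivative_compose[OF has_derivative_Pair[OF has_derivative_ident has_derivative_ident] M])
  then have "((\<lambda>y. mat 1) has_derivative (\<lambda>v. frechet_derivative M (at (x, x)) (v, v))) (at x)"
    by (rule has_derivative_transform_within_open[OF _ assms(1,4)])
       (use assms cocycle_on_diagonal in auto)
  then have "frechet_derivative M (at (x, x)) (v, v) = 0" for v
    using has_derivative_unique[OF _ has_derivative_const] by (fastforce simp: fun_eq_iff)
  then show ?thesis
    using assms by (simp add: prolong_coords_def cocycle_on_diagonal vec_eq_iff)
qed

text \<open>The prolongation is again a morphism. Its last coordinate is obtained by differentiating
  the cocycle identity of \<open>M\<close> along moving intermediate and end points, the other
  coordinates by the cocycle identities themselves.\<close>

lemma comp_prolong_coords:
  assumes "open U" "cocycle_on U M" "cocycle_on U N" "x \<in> U" "y \<in> U" "z \<in> U"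
  shows "comp_coords (prolong_coords M N (y, z)) (prolong_coords M N (x, y)) = prolong_coords M N (x, z)"
proof -
  let ?D = "\<lambda>z. frechet_derivative M (at z)"
  have M: "(M has_derivative ?D (a, b)) (at (a, b))" if "a \<in> U" "b \<in> U" for a b
    using assms that by (intro smooth_on_has_derivative[OF cocycle_onD(1)]) auto
  have lin: "linear (?D (a, b))" if "a \<in> U" "b \<in> U" for a b
    using M[OF that] has_derivative_linear by blast
  have N: "N (x, z) = N (y, z) ** N (x, y)" "M (x, z) = M (y, z) ** M (x, y)"
    using cocycle_onD(3)[OF assms(2,4-6)] cocycle_onD(3)[OF assms(3-6)] by simp_all
  \<comment> \<open>Affine representatives of the jets \<open>N (x, y)\<close> and
    \<open>N (x, z)\<close> suffice, as only first derivatives at \<open>x\<close> are taken. The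
    product \<open>M (?s w, ?t w) ** M (w, ?s w)\<close> is then differentiated in two ways.\<close>
  let ?s = "\<lambda>w. y + N (x, y) *v (w - x)" and ?t = "\<lambda>w. z + N (x, z) *v (w - x)"
  have s: "(?s has_derivative (*v) (N (x, y))) (at x)" "(?t has_derivative (*v) (N (x, z))) (at x)"
    by (auto intro!: derivative_eq_intros bounded_linear.has_derivative[OF matrix_vector_mul_bounded_linear])
  have "((\<lambda>w. M (w, ?t w)) has_derivative (\<lambda>v. ?D (x, z) (v, N (x, z) *v v))) (at x)"
    using has_derivative_compose[OF has_derivative_Pair[OF has_derivative_ident s(2)], of M "?D (x, z)"]
      M[of x z] assms by simp
  then have 1: "((\<lambda>w. M (?s w, ?t w) ** M (w, ?s w)) has_derivative
      (\<lambda>v. ?D (x, z) (v, N (x, z) *v v))) (at x)"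
  proof (rule has_derivative_transform_within_open)
    show "open (U \<inter> ?s -` U \<inter> ?t -` U)" "x \<in> U \<inter> ?s -` U \<inter> ?t -` U"
      using assms(1,4,5,6) by (auto intro!: open_Int open_vimage continuous_intros
        continuous_on_compose2[OF linear_continuous_on[OF matrix_vector_mul_bounded_linear]])
    show "M (w, ?t w) = M (?s w, ?t w) ** M (w, ?s w)" if "w \<in> U \<inter> ?s -` U \<inter> ?t -` U" for w
      using cocycle_onD(3)[OF assms(2), of w "?s w" "?t w"] that by simp
  qed
  have 2: "((\<lambda>w. M (?s w, ?t w) ** M (w, ?s w)) has_derivative
      (\<lambda>v. M (?s x, ?t x) ** ?D (x, y) (v, N (x, y) *v v) + ?D (y, z) (N (x, y) *v v, N (x, z) *v v) ** M (x, ?s x))) (at x)"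
    using has_derivative_compose[OF has_derivative_Pair[OF has_derivative_ident s(1)], of M "?D (x, y)"]
      has_derivative_compose[OF has_derivative_Pair[OF s], of M "?D (y, z)"] M assms
    by (intro bounded_bilinear.FDERIV[OF bounded_bilinear_matrix_mult]) simp_all
  note eq = has_derivative_unique[OF 1 2]
  have D: "?D (x, z) (v, N (x, z) *v v) =
      M (y, z) ** ?D (x, y) (v, N (x, y) *v v) + ?D (y, z) (N (x, y) *v v, N (y, z) *v (N (x, y) *v v)) ** M (x, y)" for v
    using fun_cong[OF eq, of v] by (simp add: N(1) matrix_vector_mul_assoc)
  have lin2: "linear (\<lambda>v. ?D (a, b) (v, N (a, b) *v v))" if "a \<in> U" "b \<in> U" for a b
    using linear_compose[OF _ lin[OF that], of "\<lambda>v. (v, N (a, b) *v v)"]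
    by (simp add: o_def linear_iff matrix_vector_right_distrib matrix_vector_mult_scaleR)
  show ?thesis
    using assms(4-6)
    by (simp add: comp_coords_def prolong_coords_def dir_coeff_linear[OF lin2] N(2) add.commute D[symmetric] flip: N(1))
qed


section \<open>Deformations and prolongations\<close>

abbreviation (input) quotient_cocycle :: "(vec3 \<Rightarrow> mat3) \<Rightarrow> vec3 \<times> vec3 \<Rightarrow> mat3" where
  "quotient_cocycle p \<equiv> \<lambda>z. matrix_inv (p (snd z)) ** p (fst z)"

lemma cocycle_on_quotient:
  assumes "open U" "smooth_on U p" "\<And>x. x \<in> U \<Longrightarrow> invertible (p x)"
  shows "cocycle_on U (quotient_cocycle p)"
proof -
  have op: "open (U \<times> U)" using assms open_Times by blast
  have id: "smooth_on (U \<times> U) (\<lambda>z. z)" by (rule smooth_on_ident[OF op])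
  have "smooth_on (U \<times> U) (\<lambda>z. p (fst z))" "smooth_on (U \<times> U) (\<lambda>z. p (snd z))"
    by (rule smooth_on_compose[OF op assms(1,2)], use op id in \<open>auto intro: smooth_on_fst smooth_on_snd\<close>)+
  then have "smooth_on (U \<times> U) (quotient_cocycle p)"
    using assms(3) by (intro smooth_on_bilinear[OF op bounded_bilinear_matrix_mult] smooth_on_matrix_inv_comp[OF op]) auto
  moreover have "matrix_inv (p z) ** p x = (matrix_inv (p z) ** p y) ** (matrix_inv (p y) ** p x)"
    if "y \<in> U" for x y z
  proof -
    have "(matrix_inv (p z) ** p y) ** (matrix_inv (p y) ** p x) =
        matrix_inv (p z) ** (p y ** matrix_inv (p y)) ** p x"
      by (simp only: matrix_mul_assoc)
    then show ?thesis by (simp add: matrix_inv[OF assms(3)[OF that]])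
  qed
  ultimately show ?thesis
    unfolding cocycle_on_def fst_conv snd_conv
    by (intro conjI ballI invertible_mult invertible_matrix_inv assms(3))
qed

lemma smooth_on_fst_slice:
  fixes f :: "'a::euclidean_space \<times> 'b::euclidean_space \<Rightarrow> 'c::real_normed_vector"
  assumes "open U" "open V" "smooth_on (U \<times> V) f" "x \<in> V"
  shows "smooth_on U (\<lambda>y. f (y, x))"
  by (rule smooth_on_compose[OF assms(1) open_Times[OF assms(1,2)] assms(3)
        smooth_on_Pair[OF assms(1) smooth_on_ident[OF assms(1)] smooth_on_const]])
     (use assms(4) in simp)

text \<open>Injectivity of \<open>\<kappa>\<close> and of its derivatives is given on frames. Both
  descend to the base map by choosing frames, respectively tangent vectors, whose images have a
  prescribed vertical part.\<close>

lemma deformationD: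
  assumes "open U" "deformation U \<kappa>"
    and k_def: "\<And>x. k x = fst (\<kappa> (x, mat 1))" and p_def: "\<And>x. p x = snd (\<kappa> (x, mat 1))"
  shows "\<And>X. fst X \<in> U \<Longrightarrow> invertible (snd X) \<Longrightarrow> \<kappa> X = (k (fst X), p (fst X) ** snd X)"
    and "smooth_on U k" "smooth_on U p" "\<And>x. x \<in> U \<Longrightarrow> invertible (p x)"
    and "inj_on \<kappa> (frame_bundle U)" "diffeo U (k ` U) k"
proof -
  have def: "\<kappa> ` frame_bundle U \<subseteq> frame_bundle UNIV" "equivariant_on U \<kappa>" "smooth_on (frame_bundle U) \<kappa>"
      "\<And>X. X \<in> frame_bundle U \<Longrightarrow> inj (frechet_derivative \<kappa> (at X))"
    using assms(2) by (auto simp: deformation_def)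
  show form: "\<kappa> X = (k (fst X), p (fst X) ** snd X)" if "fst X \<in> U" "invertible (snd X)" for X
    unfolding k_def p_def using equivariant_product_form[OF def(2) that] .
  show sm: "smooth_on U k" "smooth_on U p"
    using smooth_on_unit_slice[OF assms(1) def(3)] by (simp_all add: k_def[abs_def] p_def[abs_def])
  show inv: "invertible (p x)" if "x \<in> U" for x
    using subsetD[OF def(1) imageI, of "(x, mat 1)"] that
    by (simp add: p_def frame_bundle_eq invertible_mat1 mem_Times_iff)
  show inj: "inj_on \<kappa> (frame_bundle U)"
    using assms(2) by (auto simp: deformation_def embedding_map_def homeomorphic_eq_everything_map)
  have "inj_on k U"
  proof (rule inj_onI)
    fix x y assume xy: "x \<in> U" "y \<in> U" "k x = k y"
    \<comment> \<open>These frames are sent to the unit frames over \<open>k x\<close> and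
      \<open>k y\<close>.\<close>
    have "\<kappa> (x, matrix_inv (p x)) = \<kappa> (y, matrix_inv (p y))"
      using xy inv form[of "(x, matrix_inv (p x))"] form[of "(y, matrix_inv (p y))"]
      by (simp add: invertible_matrix_inv matrix_inv)
    then have "(x, matrix_inv (p x)) = (y, matrix_inv (p y))"
      by (rule inj_onD[OF inj]) (use xy inv in \<open>auto simp: frame_bundle_eq invertible_matrix_inv\<close>)
    then show "x = y" by simp
  qed
  moreover have "invertible (matrix (frechet_derivative k (at x)))" if x: "x \<in> U" for x
  proof -
    let ?k' = "frechet_derivative k (at x)" and ?p' = "frechet_derivative p (at x)"
    have lin: "linear ?k'" by (rule smooth_on_linear_frechet_derivative[OF sm(1) x])
    have d: "(\<kappa> has_derivative (\<lambda>w. (?k' (fst w), p x ** snd w + ?p' (fst w) ** mat 1))) (at (x, mat 1))"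
      by (rule has_derivative_product_form[OF assms(1) x invertible_mat1 form smooth_on_has_derivative[OF sm(1) x]
            smooth_on_has_derivative[OF sm(2) x]])
    have i: "inj (\<lambda>w. (?k' (fst w), p x ** snd w + ?p' (fst w) ** mat 1))"
      using def(4)[of "(x, mat 1)"] frechet_derivative_at[OF d] x by (simp add: frame_bundle_eq invertible_mat1)
    have "v = w" if "?k' v = ?k' w" for v w
    proof -
      \<comment> \<open>The matrix part of \<open>?q v\<close> cancels the matrix part of its image,
        so that this image depends on \<open>?k' v\<close> alone.\<close>
      let ?q = "\<lambda>v. (v, - (matrix_inv (p x) ** ?p' v))"
      have *: "p x ** - (matrix_inv (p x) ** ?p' v) + ?p' v ** mat 1 = 0" for v
        by (simp add: bounded_bilinear.minus_right[OF bounded_bilinear_matrix_mult] matrix_mul_assoc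
            matrix_inv[OF inv[OF x]])
      have "?q v = ?q w"
        by (rule injD[OF i]) (simp only: fst_conv snd_conv that *)
      then show ?thesis by simp
    qed
    then have "inj ((*v) (matrix ?k'))"
      using matrix_works[OF linear_matrix_vector_mul_eq[THEN iffD2, OF lin]] by (simp add: inj_def)
    then show ?thesis
      using matrix_left_invertible_injective invertible_left_inverse by blast
  qed
  ultimately show "diffeo U (k ` U) k"
    by (intro diffeo_onto_image assms(1) sm(1)) auto
qed

text \<open>The derivative is block triangular, with the Jacobian of \<open>k\<close> and left
  multiplication by \<open>p x\<close> as invertible diagonal blocks. Domain and target have equal
  dimension, so invariance of domain makes the injective map open, hence an embedding.\<close>

lemma deformation_product_form:
  assumes "diffeo U T k" "smooth_on U p" "\<And>x. x \<in> U \<Longrightarrow> invertible (p x)"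
  shows "deformation U (\<lambda>X. (k (fst X), p (fst X) ** snd X))" (is "deformation U ?\<kappa>")
proof -
  have U: "open U" "smooth_on U k" "inj_on k U" using assms(1) by (auto simp: diffeo_def bij_betw_def)
  have opF: "open (frame_bundle U)" by (rule open_frame_bundle[OF U(1)])
  have im: "?\<kappa> ` frame_bundle U \<subseteq> frame_bundle UNIV"
    using assms(3) by (auto simp: frame_bundle_eq invertible_mult)
  have eqv: "equivariant_on U ?\<kappa>"
    by (simp add: equivariant_on_def frame_act_def matrix_mul_assoc)
  have "smooth_on (frame_bundle U) fst" "\<And>X. X \<in> frame_bundle U \<Longrightarrow> fst X \<in> U"
    by (rule smooth_on_linear[OF opF bounded_linear_fst]) (auto simp: frame_bundle_eq)
  then have "smooth_on (frame_bundle U) (\<lambda>X. k (fst X))" "smooth_on (frame_bundle U) (\<lambda>X. p (fst X))"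
    using smooth_on_compose[OF opF U(1)] U(2) assms(2) by blast+
  then have sm: "smooth_on (frame_bundle U) ?\<kappa>"
    by (intro smooth_on_Pair[OF opF] smooth_on_bilinear[OF opF bounded_bilinear_matrix_mult]
        smooth_on_snd[OF opF] smooth_on_ident[OF opF])
  have cancel: "B = C" if "p x ** B = p x ** C" "x \<in> U" for x and B C :: mat3
  proof -
    have "matrix_inv (p x) ** (p x ** B) = matrix_inv (p x) ** (p x ** C)" using that(1) by simp
    then show ?thesis by (simp add: matrix_mul_assoc matrix_inv[OF assms(3)[OF that(2)]])
  qed
  have inj: "inj_on ?\<kappa> (frame_bundle U)"
    using cancel U(3) by (auto simp: inj_on_def frame_bundle_eq)
  have "inj (frechet_derivative ?\<kappa> (at X))" if "X \<in> frame_bundle U" for X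
  proof -
    obtain x A where X: "X = (x, A)" "x \<in> U" "invertible A" using \<open>X \<in> _\<close> by (auto simp: frame_bundle_eq)
    let ?k' = "frechet_derivative k (at x)" and ?p' = "frechet_derivative p (at x)"
    have lin: "linear ?k'" by (rule smooth_on_linear_frechet_derivative[OF U(2) X(2)])
    have "(?\<kappa> has_derivative (\<lambda>w. (?k' (fst w), p x ** snd w + ?p' (fst w) ** A))) (at (x, A))"
      by (rule has_derivative_product_form[OF U(1) X(2,3) refl smooth_on_has_derivative[OF U(2) X(2)]
            smooth_on_has_derivative[OF assms(2) X(2)]])
    then have fr: "frechet_derivative ?\<kappa> (at X) = (\<lambda>w. (?k' (fst w), p x ** snd w + ?p' (fst w) ** A))"
      using frechet_derivative_at[symmetric] X(1) by blast
    have injk: "inj ?k'"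
      using inj_matrix_vector_mult[OF diffeo_invertible_jacobian[OF assms(1) X(2)]]
      by (simp add: matrix_works[OF linear_matrix_vector_mul_eq[THEN iffD2, OF lin]] inj_def)
    show ?thesis
      unfolding fr
    proof (rule injI)
      fix w w' :: frame
      assume eq: "(?k' (fst w), p x ** snd w + ?p' (fst w) ** A) = (?k' (fst w'), p x ** snd w' + ?p' (fst w') ** A)"
      then have 1: "fst w = fst w'" using injD[OF injk] by blast
      have "p x ** snd w + ?p' (fst w) ** A = p x ** snd w' + ?p' (fst w) ** A"
        using eq unfolding 1 by blast
      then have "snd w = snd w'" using cancel[OF _ X(2)] add_right_cancel by blast
      with 1 show "w = w'" by (rule prod_eqI)
    qed
  qed
  moreover have "embedding_map (top_of_set (frame_bundle U)) (top_of_set (frame_bundle UNIV)) ?\<kappa>"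
  proof (rule injective_open_imp_embedding_map)
    show "continuous_map (top_of_set (frame_bundle U)) (top_of_set (frame_bundle UNIV)) ?\<kappa>"
      using im smooth_on_imp_continuous_on[OF sm] by (auto simp: continuous_map_in_subtopology)
    show "open_map (top_of_set (frame_bundle U)) (top_of_set (frame_bundle UNIV)) ?\<kappa>"
      unfolding open_map_def
    proof (intro allI impI)
      fix S assume "openin (top_of_set (frame_bundle U)) S"
      then have S: "open S" "S \<subseteq> frame_bundle U"
        using opF by (auto simp: openin_open_eq)
      have "open (?\<kappa> ` S)"
        by (rule invariance_of_domain[OF continuous_on_subset[OF smooth_on_imp_continuous_on[OF sm] S(2)] S(1)
              inj_on_subset[OF inj S(2)]])
      then show "openin (top_of_set (frame_bundle UNIV)) (?\<kappa> ` S)"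
        using im S(2) open_frame_bundle[OF open_UNIV] by (auto simp: openin_open_eq)
    qed
  qed (use inj in simp)
  ultimately show ?thesis
    using im eqv sm by (auto simp: deformation_def)
qed

text \<open>A translation leaves the matrix part of a frame alone. Its conjugate by
  \<open>\<kappa>\<close> therefore sends \<open>(x', A)\<close> to \<open>(y', B)\<close> with
  \<open>k y' = k x' + ?c\<close> and \<open>p y' ** B = p x' ** A\<close>, which is the product
  form built from \<open>quotient_cocycle p\<close>.\<close>

lemma homogeneity_jet:
  assumes "open U" "deformation U \<kappa>" "x \<in> U" "y \<in> U"
    and k_def: "\<And>x. k x = fst (\<kappa> (x, mat 1))" and p_def: "\<And>x. p x = snd (\<kappa> (x, mat 1))"
  shows "nhjet_of (inv_into (frame_bundle U) \<kappa> \<circ>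
      frame_lift (translation (base_map \<kappa> y - base_map \<kappa> x)) \<circ> \<kappa>) x =
    jet (prolong_coords (quotient_cocycle p)
      (quotient_cocycle (\<lambda>x. matrix (frechet_derivative k (at x)))) (x, y))"
proof -
  note \<kappa> = deformationD[OF assms(1,2,5,6)]
  let ?c = "k y - k x" and ?J = "\<lambda>x. matrix (frechet_derivative k (at x))"
  let ?\<psi> = "inv_into U k \<circ> translation ?c \<circ> k" and ?M = "quotient_cocycle p"
  \<comment> \<open>The conjugated translation is controlled only where the translated point stays
    in the image of \<open>k\<close>; \<open>?V\<close> is an open neighbourhood of \<open>x\<close>
    with this property.\<close>
  let ?V = "U \<inter> k -` ((\<lambda>z. z + ?c) -` (k ` U))"
  note \<psi> = translation_in_charts[OF \<kappa>(6) assms(3) \<kappa>(6) assms(4)]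
  have "open (k ` U)" using \<kappa>(6) by (simp add: diffeo_def)
  then have "open ((\<lambda>z. z + ?c) -` (k ` U))"
    by (intro open_vimage) (auto intro!: continuous_intros)
  then have V: "open ?V" "x \<in> ?V"
    using assms(3,4) continuous_open_preimage[OF smooth_on_imp_continuous_on[OF \<kappa>(2)] assms(1)] by auto
  have "frechet_derivative (translation c) (at z) = id" for c z
    by (rule frechet_derivative_at[symmetric]) (auto simp: translation_def[abs_def] id_def intro!: derivative_eq_intros)
  then have lift: "frame_lift (translation c) X = (fst X + c, snd X)" for c X
    by (simp add: frame_lift_def jacobian_at_def matrix_id_mat_1) (simp add: translation_def)
  have "nhjet_of (inv_into (frame_bundle U) \<kappa> \<circ> frame_lift (translation ?c) \<circ> \<kappa>) x =
      jet (prolong_coords ?M (quotient_cocycle ?J) (x, ?\<psi> x))"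
  proof (rule nhjet_of_prolong[where \<psi> = ?\<psi>, OF V])
    fix X :: frame assume X: "fst X \<in> ?V" "invertible (snd X)"
    obtain y' where y': "y' \<in> U" "k (fst X) + ?c = k y'" using X by auto
    then have "?\<psi> (fst X) = y'"
      using \<kappa>(6) by (simp add: translation_def diffeo_def bij_betw_def)
    have *: "invertible (?M (fst X, y') ** snd X)"
      using X y' \<kappa>(4) by (auto intro!: invertible_mult invertible_matrix_inv)
    then have "\<kappa> (y', ?M (fst X, y') ** snd X) = (k y', p y' ** (?M (fst X, y') ** snd X))"
      using y' \<kappa>(1)[of "(y', ?M (fst X, y') ** snd X)"] by simp
    also have "p y' ** (?M (fst X, y') ** snd X) = p (fst X) ** snd X"
      by (simp add: matrix_mul_assoc matrix_inv[OF \<kappa>(4)[OF y'(1)]])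
    also have "(k y', p (fst X) ** snd X) = frame_lift (translation ?c) (\<kappa> X)"
      using \<kappa>(1)[of X] X y'(2) by (simp add: lift)
    finally have "inv_into (frame_bundle U) \<kappa> (frame_lift (translation ?c) (\<kappa> X)) = (y', ?M (fst X, y') ** snd X)"
      using * y' by (intro inv_into_f_eq[OF \<kappa>(5)]) (auto simp: frame_bundle_eq)
    then show "(inv_into (frame_bundle U) \<kappa> \<circ> frame_lift (translation ?c) \<circ> \<kappa>) X =
        (?\<psi> (fst X), ?M (fst X, ?\<psi> (fst X)) ** snd X)"
      unfolding \<open>?\<psi> (fst X) = y'\<close> by simp
  next
    show "(?\<psi> has_derivative (*v) (quotient_cocycle ?J (x, ?\<psi> x))) (at x)"
      using \<psi> by simp
    show "(?M has_derivative frechet_derivative ?M (at (x, ?\<psi> x))) (at (x, ?\<psi> x))"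
      unfolding \<psi>(1) using assms(3,4)
      by (intro smooth_on_has_derivative[OF cocycle_onD(1)[OF cocycle_on_quotient[OF assms(1) \<kappa>(3,4)]]]) auto
  qed
  then show ?thesis
    unfolding \<psi>(1) by (simp add: base_map_def k_def)
qed

lemma induced_algebroid_map_prolongation:
  assumes "open U" "parallelism U P" "parallelism U Q" "x \<in> U"
  shows "induced_algebroid_map (prolongation U P Q) x v =
    frechet_derivative (\<lambda>y. prolong_coords (\<lambda>z. snd (snd (P z))) (\<lambda>z. snd (snd (Q z))) (y, x)) (at x) v"
proof -
  let ?C = "prolong_coords (\<lambda>z. snd (snd (P z))) (\<lambda>z. snd (snd (Q z)))"
  have "smooth_on (U \<times> U) ?C"
    using assms parallelism_iff_cocycle[OF assms(1)] by (intro smooth_on_prolong_coords) blast+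
  then have "smooth_on U (\<lambda>y. ?C (y, x))"
    by (rule smooth_on_fst_slice[OF assms(1,1) _ assms(4)])
  then have "(\<lambda>y. ?C (y, x)) differentiable (at x)"
    using smooth_on_has_derivative[OF _ assms(4)] differentiable_def by blast
  then have "frechet_derivative (\<lambda>y. ?C (y, x)) (at x) =
      frechet_derivative (\<lambda>y. coords (prolongation U P Q (y, x))) (at x)"
    by (rule frechet_derivative_transform_within_open[OF _ assms(1,4)])
       (use assms in \<open>simp add: prolongation_eq coords_jet\<close>)
  then show ?thesis by (simp add: induced_algebroid_map_def)
qed

lemma algebroid_prolong_coords:
  assumes "open U" "cocycle_on U M" "cocycle_on U N" "x \<in> U"
    and \<Omega>: "\<And>y. y \<in> U \<Longrightarrow> jet (prolong_coords M N (y, x)) \<in> \<Omega>"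
  shows "frechet_derivative (\<lambda>y. prolong_coords M N (y, x)) (at x) v \<in> algebroid \<Omega> x"
proof -
  let ?C = "\<lambda>y. prolong_coords M N (y, x)" and ?l = "\<lambda>t::real. x + t *\<^sub>R v"
  have smC: "smooth_on U ?C"
    by (rule smooth_on_fst_slice[OF assms(1,1) smooth_on_prolong_coords[OF assms(1-3)] assms(4)])
  have "open (?l -` U)"
    using assms(1) by (intro open_vimage) (auto intro!: continuous_intros)
  moreover have "0 \<in> ?l -` U" using assms(4) by simp
  ultimately obtain e where e: "e > 0" "ball 0 e \<subseteq> ?l -` U"
    using open_contains_ball by blast
  have I: "{-e<..<e} \<subseteq> ?l -` U" using e(2) ball_eq_greaterThanLessThan[of 0 e] by simp
  have "smooth_on {-e<..<e} ?l"
    by (intro smooth_on_add smooth_on_const smooth_on_linear bounded_linear_scaleR_left) auto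
  then have "smooth_on {-e<..<e} (\<lambda>t. ?C (?l t))"
    by (rule smooth_on_compose[OF open_greaterThanLessThan assms(1) smC]) (use I in auto)
  moreover have "(\<lambda>t. ?C (?l t)) ` {-e<..<e} \<subseteq> coords ` {p \<in> \<Omega>. target p = x}"
  proof
    fix c assume "c \<in> (\<lambda>t. ?C (?l t)) ` {-e<..<e}"
    then obtain t where t: "t \<in> {-e<..<e}" "c = ?C (?l t)" by blast
    have "jet (?C (?l t)) \<in> \<Omega>" using t I by (intro \<Omega>) auto
    moreover have "target (jet (?C (?l t))) = x" by (simp add: target_jet prolong_coords_def)
    ultimately show "c \<in> coords ` {p \<in> \<Omega>. target p = x}"
      unfolding t(2) by (intro image_eqI[of _ _ "jet (?C (?l t))"]) (auto simp: coords_jet)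
  qed
  moreover have "?C (?l 0) = coords (nhunit x)"
    by (simp add: prolong_coords_diagonal[OF assms(1-4)] nhunit_eq coords_jet)
  moreover have "((\<lambda>t. ?C (?l t)) has_vector_derivative frechet_derivative ?C (at x) v) (at 0)"
  proof -
    have "(?l has_derivative (\<lambda>t. t *\<^sub>R v)) (at 0)" by (auto intro!: derivative_eq_intros)
    then have "((\<lambda>t. ?C (?l t)) has_derivative (\<lambda>t. frechet_derivative ?C (at x) (t *\<^sub>R v))) (at 0)"
      by (rule has_derivative_compose) (use smooth_on_has_derivative[OF smC assms(4)] in simp)
    then show ?thesis
      using smooth_on_linear_frechet_derivative[OF smC assms(4)]
      by (simp add: has_vector_derivative_def linear_cmul)
  qed
  ultimately show ?thesis
    unfolding algebroid_def tangent_space_def using e(1) by blast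
qed

text \<open>The single open set \<open>B\<close> and the single chart \<open>k\<close>, the base map
  of the deformation, serve at all points.\<close>

lemma homogeneous_imp_prolongation:
  assumes "open B" "homogeneous B \<Omega>"
  shows "integrable_nonholonomic_prolongation B (algebroid \<Omega>)"
proof -
  obtain \<kappa> where \<kappa>: "deformation B \<kappa>"
    and \<Omega>: "\<And>x y. x \<in> B \<Longrightarrow> y \<in> B \<Longrightarrow> nhjet_of (inv_into (frame_bundle B) \<kappa> \<circ>
      frame_lift (translation (base_map \<kappa> y - base_map \<kappa> x)) \<circ> \<kappa>) x \<in> \<Omega>"
    using assms(2) unfolding homogeneous_def homogeneous_on_def by blast
  define k where "k = (\<lambda>x. fst (\<kappa> (x, mat 1)))"
  define p where "p = (\<lambda>x. snd (\<kappa> (x, mat 1)))"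
  note D = deformationD[OF assms(1) \<kappa>, of k p, OF k_def[THEN fun_cong] p_def[THEN fun_cong]]
  let ?J = "\<lambda>x. matrix (frechet_derivative k (at x))"
  let ?M = "quotient_cocycle p" and ?N = "quotient_cocycle ?J"
  define P where "P = (\<lambda>z. (fst z, snd z, ?M z))"
  define Q where "Q = (\<lambda>z. (fst z, snd z, ?N z))"
  have M: "cocycle_on B ?M" by (rule cocycle_on_quotient[OF assms(1) D(3,4)])
  have N: "cocycle_on B ?N"
    by (rule cocycle_on_quotient[OF assms(1) smooth_on_jacobian[OF assms(1) D(2)] diffeo_invertible_jacobian[OF D(6)]])
  have P: "parallelism B P" and Q: "parallelism B Q"
    using M N by (simp_all add: parallelism_iff_cocycle[OF assms(1)] P_def Q_def)
  have "integrable_parallelism B Q"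
    unfolding integrable_parallelism_def
  proof (intro ballI exI conjI)
    fix x0 y0 assume "x0 \<in> B" "y0 \<in> B"
    then show "chart_around B x0 B k" "chart_around B y0 B k"
      using D(6) by (auto simp: chart_around_def)
    fix x y assume xy: "x \<in> B" "y \<in> B"
    note t = translation_in_charts[OF D(6) xy(1) D(6) xy(2)]
    show "Q (x, y) = pjet_of (inv_into B k \<circ> translation (k y - k x) \<circ> k) x"
      using t(1) frechet_derivative_at[OF t(2), symmetric] by (simp add: Q_def pjet_of_def jacobian_at_def)
  qed
  moreover have "induced_algebroid_map (prolongation B P Q) z v \<in> algebroid \<Omega> z" if "z \<in> B" for z v
  proof -
    have "frechet_derivative (\<lambda>y. prolong_coords ?M ?N (y, z)) (at z) v \<in> algebroid \<Omega> z"
    proof (rule algebroid_prolong_coords[OF assms(1) M N that])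
      fix y assume "y \<in> B"
      then show "jet (prolong_coords ?M ?N (y, z)) \<in> \<Omega>"
        using \<Omega>[of y z] that homogeneity_jet[OF assms(1) \<kappa>, of y z k p] by (simp add: k_def p_def)
    qed
    then show ?thesis
      unfolding induced_algebroid_map_prolongation[OF assms(1) P Q that] by (simp add: P_def Q_def)
  qed
  ultimately show ?thesis
    unfolding integrable_nonholonomic_prolongation_def using assms(1) P Q by blast
qed


section \<open>Prolongations in a Lie subgroupoid\<close>

text \<open>Used to split off the transverse coordinate of a slice chart:
  \<open>w - \<rho> w\<close> vanishes exactly on \<open>L\<close>.\<close>

lemma linear_projection_onto_subspace:
  fixes L :: "'a::euclidean_space set"
  assumes "subspace L"
  obtains \<rho> where "linear \<rho>" "\<And>w. \<rho> w \<in> L" "\<And>w. w \<in> L \<Longrightarrow> \<rho> w = w"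
proof -
  have "\<exists>\<rho>. range \<rho> \<subseteq> L \<and> linear \<rho> \<and> (\<forall>w\<in>L. \<rho> (id w) = w)"
    by (rule linear_exists_left_inverse_on[OF linear_id assms]) simp
  then show ?thesis using that by auto
qed

lemma has_vector_derivative_chain:
  assumes "(f has_vector_derivative v) (at t)" "(g has_derivative g') (at (f t))"
  shows "((\<lambda>t. g (f t)) has_vector_derivative g' v) (at t)"
  using vector_derivative_diff_chain_within[OF assms(1) has_derivative_at_withinI[OF assms(2)]]
  by (simp add: o_def)

text \<open>Tangency is asked for at points of \<open>S\<close> only and is witnessed by curves,
  which is what left translation in a groupoid produces. The conclusion is one-sided in time, like
  the differential inequality behind it; later the opposite side comes from reversing the direction
  of the curve.\<close>

lemma curve_stays_in_submanifold:
  fixes S :: "'a::euclidean_space set"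
  assumes S: "embedded_submanifold S" and D: "open D" "smooth_on D F"
    and tangent: "\<And>q. q \<in> S \<Longrightarrow> q \<in> D \<Longrightarrow>
      \<exists>\<beta> e::real. e > 0 \<and> \<beta> 0 = q \<and> (\<forall>t. \<bar>t\<bar> < e \<longrightarrow> \<beta> t \<in> S) \<and> (\<beta> has_vector_derivative F q) (at 0)"
    and g: "e > 0" "g 0 \<in> S"
      "\<And>t. \<bar>t\<bar> < e \<Longrightarrow> g t \<in> D" "\<And>t::real. \<bar>t\<bar> < e \<Longrightarrow> (g has_vector_derivative F (g t)) (at t)"
  obtains d where "d > 0" "\<And>t. 0 \<le> t \<Longrightarrow> t < d \<Longrightarrow> g t \<in> S"
proof -
  obtain L where L: "subspace L"
    and slice: "\<And>p. p \<in> S \<Longrightarrow> \<exists>(N::'a set) (N'::'a set) \<phi>. p \<in> N \<and> diffeo N N' \<phi> \<and> \<phi> ` (S \<inter> N) = L \<inter> N'"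
    using S unfolding embedded_submanifold_def by blast
  obtain N N' :: "'a set" and \<phi> where N: "g 0 \<in> N" "diffeo N N' \<phi>" and im: "\<phi> ` (S \<inter> N) = L \<inter> N'"
    using slice[OF g(2)] by blast
  define \<phi>i where "\<phi>i = inv_into N \<phi>"
  have \<phi>: "open N" "open N'" "smooth_on N \<phi>" "smooth_on N' \<phi>i" "inj_on \<phi> N" "\<And>q. q \<in> N \<Longrightarrow> \<phi> q \<in> N'"
    using N(2) by (auto simp: diffeo_def bij_betw_def \<phi>i_def)
  have i: "\<phi>i (\<phi> q) = q" if "q \<in> N" for q using \<phi>(5) that by (simp add: \<phi>i_def)
  have i': "\<phi>i w \<in> N" "\<phi> (\<phi>i w) = w" if "w \<in> N'" for w
    using N(2) that by (auto simp: diffeo_def bij_betw_def \<phi>i_def inv_into_into f_inv_into_f)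
  have inS: "q \<in> S" if "q \<in> N" "\<phi> q \<in> L" for q
  proof -
    have "\<phi> q \<in> \<phi> ` (S \<inter> N)" unfolding im using that \<phi>(6) by blast
    then show ?thesis using \<phi>(5) that(1) by (auto dest: inj_onD)
  qed
  obtain \<rho> where \<rho>: "linear \<rho>" "\<And>w. \<rho> w \<in> L" "\<And>w. w \<in> L \<Longrightarrow> \<rho> w = w"
    using linear_projection_onto_subspace[OF L] by blast
  define \<pi> where "\<pi> = (\<lambda>w. w - \<rho> w)"
  have \<rho>b: "bounded_linear \<rho>" using \<rho>(1) by (rule linear_conv_bounded_linear[THEN iffD1])
  have \<pi>: "bounded_linear \<pi>"
    unfolding \<pi>_def by (intro bounded_linear_sub bounded_linear_ident \<rho>b)
  have \<pi>0: "\<pi> w = 0 \<longleftrightarrow> w \<in> L" for w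
    using \<rho>(2)[of w] \<rho>(3)[of w] by (auto simp: \<pi>_def)
  define W where "W = N' \<inter> \<phi>i -` D"
  have W: "open W"
    unfolding W_def by (rule continuous_open_preimage[OF smooth_on_imp_continuous_on[OF \<phi>(4)] \<phi>(2) D(1)])
  \<comment> \<open>The transverse part of \<open>F\<close>, read in the slice chart.\<close>
  define Z where "Z = (\<lambda>w. \<pi> (frechet_derivative \<phi> (at (\<phi>i w)) (F (\<phi>i w))))"
  have sm\<phi>i: "smooth_on W \<phi>i" by (rule smooth_on_subset[OF \<phi>(4)]) (auto simp: W_def)
  have "smooth_on W (\<lambda>w. F (\<phi>i w))"
    by (rule smooth_on_compose[OF W D sm\<phi>i]) (auto simp: W_def)
  then have "smooth_on W (\<lambda>w. frechet_derivative \<phi> (at (\<phi>i w)) (F (\<phi>i w)))"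
    by (rule smooth_on_frechet_derivative[OF W \<phi>(1,3) sm\<phi>i]) (auto simp: W_def i')
  then have "smooth_on W Z"
    unfolding Z_def by (rule smooth_on_linear_comp[OF W \<pi>])
  then have smZ: "Ck_on 1 W Z" by (simp add: smooth_on_def)
  have chain: "((\<lambda>t. \<pi> (\<phi> (\<beta> t))) has_vector_derivative Z (\<phi> (\<beta> s))) (at s)"
    if "(\<beta> has_vector_derivative F (\<beta> s)) (at s)" "\<beta> s \<in> N" for \<beta> :: "real \<Rightarrow> 'a" and s
  proof -
    have "((\<lambda>t. \<phi> (\<beta> t)) has_vector_derivative frechet_derivative \<phi> (at (\<beta> s)) (F (\<beta> s))) (at s)"
      by (rule has_vector_derivative_chain[OF that(1) smooth_on_has_derivative[OF \<phi>(3) that(2)]])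
    then show ?thesis
      using bounded_linear.has_vector_derivative[OF \<pi>] by (simp add: Z_def i[OF that(2)])
  qed
  \<comment> \<open>The witnessing curve lies in \<open>S\<close>, so its transverse coordinate is
    zero near time 0, and so is the derivative of that coordinate.\<close>
  have Z0: "Z w = 0" if "w \<in> L" "w \<in> W" for w
  proof -
    have w: "\<phi>i w \<in> N" "\<phi> (\<phi>i w) = w" "\<phi>i w \<in> D" using that i' by (auto simp: W_def)
    then have "\<phi>i w \<in> S" using inS that(1) by simp
    then obtain \<beta> and e :: real where \<beta>: "e > 0" "\<beta> 0 = \<phi>i w" "\<And>t. \<bar>t\<bar> < e \<Longrightarrow> \<beta> t \<in> S"
        "(\<beta> has_vector_derivative F (\<phi>i w)) (at 0)"
      using tangent w(3) by blast
    have der: "((\<lambda>t. \<pi> (\<phi> (\<beta> t))) has_vector_derivative Z w) (at 0)"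
      using chain[of \<beta> 0] \<beta>(2,4) w by simp
    have "isCont \<beta> 0" using \<beta>(4) by (rule has_vector_derivative_continuous)
    then have "\<forall>\<^sub>F t in at 0. \<beta> t \<in> N"
      using topological_tendstoD[OF isContD[OF \<open>isCont \<beta> 0\<close>] \<phi>(1)] \<beta>(2) w(1) by simp
    then obtain d where d: "d > 0" "\<And>t. t \<noteq> 0 \<Longrightarrow> \<bar>t\<bar> < d \<Longrightarrow> \<beta> t \<in> N"
      unfolding eventually_at by (auto simp: dist_real_def)
    have "\<pi> (\<phi> (\<beta> t)) = 0" if "\<bar>t\<bar> < min d e" for t
    proof -
      have "\<beta> t \<in> S \<inter> N" using \<beta>(2) \<beta>(3)[of t] d(2)[of t] that w(1) by (cases "t = 0") auto
      then show ?thesis using im \<pi>0 by blast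
    qed
    then have "((\<lambda>t::real. 0) has_vector_derivative Z w) (at 0)"
      using has_vector_derivative_transform_within[OF der, of "min d e" "\<lambda>t. 0"] d(1) \<beta>(1)
      by (auto simp: dist_real_def)
    then show ?thesis
      using vector_derivative_at has_vector_derivative_const by fastforce
  qed
  let ?w0 = "\<phi> (g 0)"
  have g0: "g 0 \<in> D" using g(1,3) by simp
  then have w0: "?w0 \<in> W" "?w0 \<in> L"
    using N(1) im g(2) by (auto simp: W_def \<phi> i)
  obtain r C where r: "r > 0" "cball ?w0 r \<subseteq> W" "C \<ge> 0"
    "\<And>y z. y \<in> cball ?w0 r \<Longrightarrow> z \<in> cball ?w0 r \<Longrightarrow> norm (Z y - Z z) \<le> C * norm (y - z)"
    using C1_locally_lipschitz[OF smZ W w0(1)] by blast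
  \<comment> \<open>The Lipschitz bound will compare \<open>\<phi> q\<close> with its projection to
    \<open>L\<close>, so both have to lie in the ball. As \<open>Z\<close> vanishes at the
    projection, the bound becomes one by the transverse coordinate.\<close>
  define K where "K = N \<inter> \<phi> -` (ball ?w0 r \<inter> \<rho> -` ball ?w0 r)"
  have "open K"
    unfolding K_def
    by (intro continuous_open_preimage[OF smooth_on_imp_continuous_on[OF \<phi>(3)] \<phi>(1)] open_Int open_vimage
        linear_continuous_on[OF \<rho>b]) auto
  moreover have "g 0 \<in> K" using N(1) w0(2) r(1) by (simp add: K_def \<rho>(3))
  moreover have "isCont g 0" using g(1,4) has_vector_derivative_continuous by force
  ultimately have "\<forall>\<^sub>F t in at 0. g t \<in> K"
    using topological_tendstoD[OF isContD] by blast
  then obtain d where d: "d > 0" "\<And>t. t \<noteq> 0 \<Longrightarrow> \<bar>t\<bar> < d \<Longrightarrow> g t \<in> K"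
    unfolding eventually_at by (auto simp: dist_real_def)
  then have inK: "g t \<in> K" if "\<bar>t\<bar> < d" for t using \<open>g 0 \<in> K\<close> that by (cases "t = 0") auto
  show ?thesis
  proof (rule that[of "min d e"])
    show "min d e > 0" using d(1) g(1) by simp
    fix T assume T: "0 \<le> T" "T < min d e"
    have "\<pi> (\<phi> (g T)) = 0"
    proof (rule gronwall_zero[where u = "\<lambda>t. \<pi> (\<phi> (g t))" and u' = "\<lambda>t. Z (\<phi> (g t))" and C = C])
      show "\<pi> (\<phi> (g 0)) = 0" using w0 \<pi>0 by blast
      fix t assume t: "0 \<le> t" "t \<le> T"
      then have t': "\<bar>t\<bar> < d" "\<bar>t\<bar> < e" using T by auto
      have gt: "g t \<in> N" "\<phi> (g t) \<in> cball ?w0 r" "\<rho> (\<phi> (g t)) \<in> cball ?w0 r"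
        using inK[OF t'(1)] by (auto simp: K_def)
      show "((\<lambda>t. \<pi> (\<phi> (g t))) has_vector_derivative Z (\<phi> (g t))) (at t)"
        by (rule chain[OF g(4)[OF t'(2)] gt(1)])
      have "Z (\<rho> (\<phi> (g t))) = 0" using Z0 \<rho>(2) gt(3) r(2) by blast
      then show "norm (Z (\<phi> (g t))) \<le> C * norm (\<pi> (\<phi> (g t)))"
        using r(4)[OF gt(2,3)] by (simp add: \<pi>_def)
    qed (rule T(1))
    then have "\<phi> (g T) \<in> L" using \<pi>0 by blast
    then show "g T \<in> S" using inS inK[of T] T by (auto simp: K_def)
  qed
qed

section \<open>The left-invariant vector field of a prolongation\<close>

lemma smooth_on_dir_coeff:
  assumes "open S" "smooth_on S T" "smooth_on S v"
  shows "smooth_on S (\<lambda>x. dir_coeff (T x) (v x))"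
  unfolding dir_coeff_def
  by (intro smooth_on_sum[OF assms(1)] smooth_on_bilinear[OF assms(1) bounded_bilinear_scaleR]
      smooth_on_vec_nth[OF assms(1)] assms)

lemma comp_coords_alt:
  "comp_coords q p = (fst p, fst (snd q), fst (snd (snd q)) ** fst (snd (snd p)),
     fst (snd (snd (snd q))) ** fst (snd (snd (snd p))),
     \<chi> k. dir_coeff (snd (snd (snd (snd q)))) (fst (snd (snd (snd p))) *v axis k 1) ** fst (snd (snd p)) +
       fst (snd (snd q)) ** dir_coeff (snd (snd (snd (snd p)))) (axis k 1))"
  by (simp add: comp_coords_def split_beta)

lemma smooth_on_comp_coords:
  assumes S: "open S" and f: "smooth_on S f" and g: "smooth_on S g"
  shows "smooth_on S (\<lambda>x. comp_coords (f x) (g x))"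
proof -
  note fs = smooth_on_fst[OF S] and sn = smooth_on_snd[OF S]
  note mm = smooth_on_bilinear[OF S bounded_bilinear_matrix_mult]
    and mv = smooth_on_bilinear[OF S bounded_bilinear_matrix_vector_mult]
  note f' = fs[OF sn[OF f]] fs[OF sn[OF sn[OF f]]] fs[OF sn[OF sn[OF sn[OF f]]]] sn[OF sn[OF sn[OF sn[OF f]]]]
  note g' = fs[OF g] fs[OF sn[OF sn[OF g]]] fs[OF sn[OF sn[OF sn[OF g]]]] sn[OF sn[OF sn[OF sn[OF g]]]]
  show ?thesis
    unfolding comp_coords_alt
    by (intro smooth_on_Pair[OF S] smooth_on_vec_lambda[OF S] smooth_on_add[OF S] mm f' g'
        smooth_on_dir_coeff[OF S] mv smooth_on_const)
qed

lemma comp_coords_unit: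
  "comp_coords q (fst q, fst q, mat 1, mat 1, 0) = q"
  by (cases q) (simp add: comp_coords_def dir_coeff_axis vec_eq_iff)

lemma lie_subgroupoidD:
  assumes "lie_subgroupoid B \<Omega>"
  shows "\<Omega> \<subseteq> J1 B" "x \<in> B \<Longrightarrow> nhunit x \<in> \<Omega>"
    "p \<in> \<Omega> \<Longrightarrow> q \<in> \<Omega> \<Longrightarrow> source q = target p \<Longrightarrow> q \<odot> p \<in> \<Omega>"
    "p \<in> \<Omega> \<Longrightarrow> nhinv p \<in> \<Omega>" "embedded_submanifold (coords ` \<Omega>)"
  using assms unfolding lie_subgroupoid_def by blast+

text \<open>\<open>F\<close> below is the left-invariant vector field \<open>q \<mapsto> T L\<^sub>q (AS(v))\<close>, of which \<open>t \<mapsto> S(z + t v, z)\<close> is an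
  integral curve because \<open>S\<close> is a morphism.\<close>

lemma prolong_coords_locally_in_subgroupoid:
  assumes \<Omega>: "lie_subgroupoid B \<Omega>" and U: "open U" "U \<subseteq> B"
    and M: "cocycle_on U M" and N: "cocycle_on U N"
    and tangent: "\<And>x v. x \<in> U \<Longrightarrow>
      frechet_derivative (\<lambda>y. prolong_coords M N (y, x)) (at x) v \<in> algebroid \<Omega> x"
    and z: "z \<in> U"
  obtains d where "d > 0" "\<And>t. 0 \<le> t \<Longrightarrow> t < d \<Longrightarrow> jet (prolong_coords M N (z + t *\<^sub>R v, z)) \<in> \<Omega>"
proof -
  note G = lie_subgroupoidD[OF \<Omega>]
  let ?C = "prolong_coords M N"
  have smC: "smooth_on (U \<times> U) ?C" by (rule smooth_on_prolong_coords[OF U(1) M N])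
  \<comment> \<open>\<open>H (q, y)\<close> is the product of \<open>q\<close> with
    \<open>S (y, s)\<close>, where \<open>s\<close>, the source of \<open>q\<close>, is its first
    coordinate; on \<open>E\<close> both \<open>s\<close> and \<open>y\<close> lie in
    \<open>U\<close>. Differentiating in \<open>y\<close> at \<open>s\<close> gives the field
    \<open>F\<close>.\<close>
  define E where "E = (fst -` U :: nhcoord set) \<times> U"
  define H where "H = (\<lambda>X. comp_coords (fst X) (?C (snd X, fst (fst X))))"
  define D :: "nhcoord set" where "D = fst -` U"
  define F where "F = (\<lambda>q. frechet_derivative H (at (q, fst q)) (0, v))"
  have D: "open D" unfolding D_def by (rule open_vimage_fst[OF U(1)])
  have E: "open E" using D U(1) by (simp add: E_def D_def open_Times)
  have idE: "smooth_on E (\<lambda>X. X)" by (rule smooth_on_ident[OF E])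
  have "smooth_on E (\<lambda>X. ?C (snd X, fst (fst X)))"
    by (rule smooth_on_compose[OF E open_Times[OF U(1,1)] smC smooth_on_Pair[OF E smooth_on_snd[OF E idE]
          smooth_on_fst[OF E smooth_on_fst[OF E idE]]]]) (auto simp: E_def)
  then have smH: "smooth_on E H"
    unfolding H_def by (rule smooth_on_comp_coords[OF E smooth_on_fst[OF E idE]])
  have idD: "smooth_on D (\<lambda>q. q)" by (rule smooth_on_ident[OF D])
  have smF: "smooth_on D F"
    unfolding F_def
    by (rule smooth_on_frechet_derivative[OF D E smH smooth_on_Pair[OF D idD smooth_on_fst[OF D idD]] smooth_on_const])
       (auto simp: D_def E_def)
  have derH: "((\<lambda>t. H (q, fst q + (t - s) *\<^sub>R v)) has_vector_derivative F q) (at s)" if "q \<in> D" for q s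
  proof -
    have 1: "((\<lambda>t. (q, fst q + (t - s) *\<^sub>R v)) has_vector_derivative (0, v)) (at s)"
      by (auto intro!: has_vector_derivative_Pair derivative_eq_intros)
    have "(H has_derivative frechet_derivative H (at (q, fst q))) (at (q, fst q))"
      using that by (intro smooth_on_has_derivative[OF smH]) (auto simp: E_def D_def)
    then show ?thesis
      using has_vector_derivative_chain[OF 1] by (simp add: F_def)
  qed
  let ?g = "\<lambda>t. ?C (z + t *\<^sub>R v, z)"
  have "open ((\<lambda>t::real. z + t *\<^sub>R v) -` U)"
    using U(1) by (intro open_vimage) (auto intro!: continuous_intros)
  moreover have "0 \<in> (\<lambda>t::real. z + t *\<^sub>R v) -` U" using z by simp
  ultimately obtain e where "e > 0" "ball 0 e \<subseteq> (\<lambda>t::real. z + t *\<^sub>R v) -` U"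
    using open_contains_ball by blast
  then have e: "e > 0" "\<And>t. \<bar>t\<bar> < e \<Longrightarrow> z + t *\<^sub>R v \<in> U" by (auto simp: ball_def dist_real_def subset_iff)
  have inD: "?g t \<in> D" if "\<bar>t\<bar> < e" for t
    using e(2)[OF that] by (simp add: D_def prolong_coords_def)
  \<comment> \<open>By the morphism property, \<open>S (z + t' v, z)\<close> is
    \<open>S (z + t v, z)\<close> composed with \<open>S (z + t' v, z + t v)\<close>. Near
    \<open>t\<close> the curve is thus \<open>H\<close> with its first argument frozen at
    \<open>?g t\<close>.\<close>
  have derg: "(?g has_vector_derivative F (?g t)) (at t)" if t: "\<bar>t\<bar> < e" for t
  proof (rule has_vector_derivative_transform_within[OF derH[OF inD[OF t]]])
    show "0 < e - \<bar>t\<bar>" using t by simp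
    fix t' assume "dist t' t < e - \<bar>t\<bar>"
    then have "\<bar>t'\<bar> < e" by (auto simp: dist_real_def)
    then show "H (?g t, fst (?g t) + (t' - t) *\<^sub>R v) = ?g t'"
      using comp_prolong_coords[OF U(1) M N e(2)[of t'] e(2)[OF t] z]
      by (simp add: H_def prolong_coords_def algebra_simps)
  qed simp
  \<comment> \<open>The algebroid element is the velocity of a curve in the target fibre over the
    source of \<open>q\<close>. Left translation by \<open>q\<close> keeps that curve in
    \<open>\<Omega>\<close> and turns its velocity into \<open>F q\<close>.\<close>
  have tang: "\<exists>\<beta> e::real. e > 0 \<and> \<beta> 0 = q \<and> (\<forall>t. \<bar>t\<bar> < e \<longrightarrow> \<beta> t \<in> coords ` \<Omega>) \<and>
      (\<beta> has_vector_derivative F q) (at 0)" if q: "q \<in> coords ` \<Omega>" "q \<in> D" for q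
  proof -
    let ?s = "fst q" and ?unit = "(fst q, fst q, mat 1, mat 1, 0) :: nhcoord"
    have s: "?s \<in> U" using q(2) by (simp add: D_def)
    obtain p where p: "p \<in> \<Omega>" "q = coords p" using q(1) by blast
    have "p \<in> J1 B" using p(1) G(1) by blast
    then have pq: "p = jet q" "source p = ?s" unfolding p(2) by (rule J1_jet)+
    have "frechet_derivative (\<lambda>y. ?C (y, ?s)) (at ?s) v \<in> algebroid \<Omega> ?s" by (rule tangent[OF s])
    then obtain \<gamma> and e :: real where \<gamma>: "e > 0" "\<gamma> ` {-e<..<e} \<subseteq> coords ` {p \<in> \<Omega>. target p = ?s}"
        "\<gamma> 0 = coords (nhunit ?s)"
        "(\<gamma> has_vector_derivative frechet_derivative (\<lambda>y. ?C (y, ?s)) (at ?s) v) (at 0)"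
      unfolding algebroid_def tangent_space_def by blast
    have \<gamma>0: "\<gamma> 0 = ?unit" by (simp add: \<gamma>(3) nhunit_eq coords_jet)
    have C0: "?C (?s, ?s) = ?unit" by (rule prolong_coords_diagonal[OF U(1) M N s])
    define m' where "m' = frechet_derivative (comp_coords q) (at ?unit)"
    have "smooth_on UNIV (comp_coords q)"
      by (rule smooth_on_comp_coords[OF open_UNIV smooth_on_const smooth_on_ident[OF open_UNIV]])
    then have m': "(comp_coords q has_derivative m') (at ?unit)"
      unfolding m'_def by (rule smooth_on_has_derivative) simp
    have "((\<lambda>y. ?C (y, ?s)) has_derivative frechet_derivative (\<lambda>y. ?C (y, ?s)) (at ?s)) (at ?s)"
      by (rule smooth_on_has_derivative[OF smooth_on_fst_slice[OF U(1,1) smC s] s])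
    moreover have "((\<lambda>t::real. ?s + (t - 0) *\<^sub>R v) has_vector_derivative v) (at 0)"
      by (auto intro!: derivative_eq_intros)
    ultimately have "((\<lambda>t::real. ?C (?s + (t - 0) *\<^sub>R v, ?s)) has_vector_derivative
        frechet_derivative (\<lambda>y. ?C (y, ?s)) (at ?s) v) (at 0)"
      using has_vector_derivative_chain[of "\<lambda>t::real. ?s + (t - 0) *\<^sub>R v" v 0 "\<lambda>y. ?C (y, ?s)"] by simp
    from has_vector_derivative_chain[OF this, of "comp_coords q" m']
    have "((\<lambda>t. H (q, ?s + (t - 0) *\<^sub>R v)) has_vector_derivative
        m' (frechet_derivative (\<lambda>y. ?C (y, ?s)) (at ?s) v)) (at 0)"
      using m' by (simp add: H_def C0)
    \<comment> \<open>Two computations of one velocity: \<open>F q\<close> is the derivative at the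
      unit of left multiplication by \<open>q\<close>, applied to the algebroid element.\<close>
    from vector_derivative_unique_at[OF this derH[OF q(2)]]
    have F: "F q = m' (frechet_derivative (\<lambda>y. ?C (y, ?s)) (at ?s) v)" by simp
    have "((\<lambda>t. comp_coords q (\<gamma> t)) has_vector_derivative F q) (at 0)"
      unfolding F using has_vector_derivative_chain[OF \<gamma>(4), of "comp_coords q" m'] m' by (simp add: \<gamma>0)
    moreover have "comp_coords q (\<gamma> 0) = q" unfolding \<gamma>0 by (rule comp_coords_unit)
    moreover have "comp_coords q (\<gamma> t) \<in> coords ` \<Omega>" if "\<bar>t\<bar> < e" for t
    proof -
      have "\<gamma> t \<in> coords ` {p \<in> \<Omega>. target p = ?s}" using \<gamma>(2) that by (auto simp: abs_less_iff)
      then obtain p' where p': "p' \<in> \<Omega>" "target p' = ?s" "\<gamma> t = coords p'" by blast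
      then have J: "p' \<in> J1 B" using G(1) by blast
      have "p \<odot> p' \<in> \<Omega>" by (rule G(3)[OF p'(1) p(1)]) (simp add: pq(2) p'(2))
      moreover have "p' = jet (\<gamma> t)" unfolding p'(3) by (rule J1_jet(1)[OF J])
      moreover have "jet q \<odot> jet (\<gamma> t) = jet (comp_coords q (\<gamma> t))"
        using J1_jet(2,6)[OF J] p'(2,3) by (intro nhcomp_jet) simp_all
      ultimately have "jet (comp_coords q (\<gamma> t)) \<in> \<Omega>" by (simp only: pq(1))
      then have "coords (jet (comp_coords q (\<gamma> t))) \<in> coords ` \<Omega>" by (rule imageI)
      then show ?thesis by (simp only: coords_jet)
    qed
    ultimately show ?thesis
      using \<gamma>(1) by (intro exI[of _ "\<lambda>t. comp_coords q (\<gamma> t)"] exI[of _ e]) simp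
  qed
  have "?g 0 \<in> coords ` \<Omega>"
    using G(2)[of z] U(2) z
    by (intro image_eqI[of _ _ "nhunit z"]) (auto simp: prolong_coords_diagonal[OF U(1) M N z] nhunit_eq coords_jet)
  from curve_stays_in_submanifold[OF G(5) D smF tang e(1) this inD derg]
  obtain d where d: "d > 0" "\<And>t. 0 \<le> t \<Longrightarrow> t < d \<Longrightarrow> ?g t \<in> coords ` \<Omega>" by blast
  have "jet (?g t) \<in> \<Omega>" if "0 \<le> t" "t < d" for t
  proof -
    have "?g t \<in> coords ` \<Omega>" by (rule d(2)[OF that])
    then obtain p where p: "p \<in> \<Omega>" "?g t = coords p" by blast
    have "jet (?g t) = p"
      unfolding p(2) by (rule J1_jet(1)[symmetric, OF subsetD[OF G(1) p(1)]])
    then show ?thesis using p(1) by (simp only:)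
  qed
  with d(1) show ?thesis using that by blast
qed

text \<open>The local result gives a range of parameters that depends on the direction, hence
  openness of classes along a line only. The argument therefore runs on the segment from
  \<open>z\<close> to \<open>y\<close>, where two directions occur, and convexity keeps the segment
  in \<open>U\<close>.\<close>

lemma prolong_coords_in_subgroupoid:
  assumes \<Omega>: "lie_subgroupoid B \<Omega>" and U: "open U" "U \<subseteq> B"
    and M: "cocycle_on U M" and N: "cocycle_on U N"
    and tangent: "\<And>x v. x \<in> U \<Longrightarrow>
      frechet_derivative (\<lambda>y. prolong_coords M N (y, x)) (at x) v \<in> algebroid \<Omega> x"
    and V: "convex V" "V \<subseteq> U" "y \<in> V" "z \<in> V"
  shows "jet (prolong_coords M N (y, z)) \<in> \<Omega>"
proof -
  note G = lie_subgroupoidD[OF \<Omega>]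
  let ?C = "prolong_coords M N"
  have sym: "jet (?C (b, a)) \<in> \<Omega>" if "a \<in> U" "b \<in> U" "jet (?C (a, b)) \<in> \<Omega>" for a b
  proof -
    have "nhinv (jet (?C (a, b))) = jet (?C (b, a))"
      using that by (intro nhinv_jet)
        (simp_all add: comp_prolong_coords[OF U(1) M N] prolong_coords_diagonal[OF U(1) M N],
         simp_all add: prolong_coords_def)
    then show ?thesis using G(4)[OF that(3)] by simp
  qed
  have trans: "jet (?C (a, c)) \<in> \<Omega>"
    if "a \<in> U" "b \<in> U" "c \<in> U" "jet (?C (a, b)) \<in> \<Omega>" "jet (?C (b, c)) \<in> \<Omega>" for a b c
  proof -
    have "jet (?C (b, c)) \<odot> jet (?C (a, b)) \<in> \<Omega>"
      by (rule G(3)[OF that(4,5)]) (simp add: source_jet target_jet prolong_coords_def)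
    moreover have "jet (?C (b, c)) \<odot> jet (?C (a, b)) = jet (comp_coords (?C (b, c)) (?C (a, b)))"
      using that cocycle_onD(2)[OF M that(1,2)]
      by (intro nhcomp_jet) (simp_all add: prolong_coords_def jet_coeff_def)
    ultimately show ?thesis by (simp add: comp_prolong_coords[OF U(1) M N that(1-3)])
  qed
  let ?l = "\<lambda>t. z + t *\<^sub>R (y - z)"
  have l: "?l t \<in> V" if "t \<in> {0..1}" for t
    using convexD_alt[OF V(1) V(4,3), of t] that by (simp add: algebra_simps)
  then have lU: "?l t \<in> U" if "t \<in> {0..1}" for t using that V(2) by blast
  have "jet (?C (?l 1, ?l 0)) \<in> \<Omega>"
  proof (rule connected_equivalence_relation[where S = "{0..1::real}" and R = "\<lambda>s t. jet (?C (?l t, ?l s)) \<in> \<Omega>"])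
    fix a :: real assume a: "a \<in> {0..1}"
    obtain d1 where d1: "d1 > 0" "\<And>t. 0 \<le> t \<Longrightarrow> t < d1 \<Longrightarrow> jet (?C (?l a + t *\<^sub>R (y - z), ?l a)) \<in> \<Omega>"
      using prolong_coords_locally_in_subgroupoid[OF \<Omega> U M N tangent lU[OF a]] by blast
    \<comment> \<open>The reversed direction covers the parameters below \<open>a\<close>, since the
      local result is one-sided.\<close>
    obtain d2 where d2: "d2 > 0" "\<And>t. 0 \<le> t \<Longrightarrow> t < d2 \<Longrightarrow> jet (?C (?l a + t *\<^sub>R (- (y - z)), ?l a)) \<in> \<Omega>"
      using prolong_coords_locally_in_subgroupoid[OF \<Omega> U M N tangent lU[OF a]] by blast
    show "\<exists>T. openin (top_of_set {0..1}) T \<and> a \<in> T \<and> (\<forall>t\<in>T. jet (?C (?l t, ?l a)) \<in> \<Omega>)"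
    proof (intro exI conjI ballI)
      show "openin (top_of_set {0..1}) ({0..1} \<inter> {a - d2<..<a + d1})" by (simp add: openin_open_Int)
      show "a \<in> {0..1} \<inter> {a - d2<..<a + d1}" using a d1(1) d2(1) by simp
      fix t assume t: "t \<in> {0..1} \<inter> {a - d2<..<a + d1}"
      show "jet (?C (?l t, ?l a)) \<in> \<Omega>"
      proof (cases "a \<le> t")
        case True
        have eq: "?l t = ?l a + (t - a) *\<^sub>R (y - z)" by (simp add: algebra_simps)
        have "0 \<le> t - a" "t - a < d1" using True t by auto
        from d1(2)[OF this] show ?thesis by (simp only: eq)
      next
        case False
        have eq: "?l t = ?l a + (a - t) *\<^sub>R (- (y - z))" by (simp add: algebra_simps)
        have "0 \<le> a - t" "a - t < d2" using False t by auto
        from d2(2)[OF this] show ?thesis by (simp only: eq)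
      qed
    qed
  next
    show "jet (?C (?l s, ?l t)) \<in> \<Omega>" if "s \<in> {0..1}" "t \<in> {0..1}" "jet (?C (?l t, ?l s)) \<in> \<Omega>" for s t
      by (rule sym[OF lU[OF that(2)] lU[OF that(1)] that(3)])
    show "jet (?C (?l u, ?l s)) \<in> \<Omega>"
      if "s \<in> {0..1}" "t \<in> {0..1}" "u \<in> {0..1}" "jet (?C (?l t, ?l s)) \<in> \<Omega>" "jet (?C (?l u, ?l t)) \<in> \<Omega>" for s t u
      by (rule trans[OF lU[OF that(3)] lU[OF that(2)] lU[OF that(1)] that(5,4)])
  qed auto
  then show ?thesis by simp
qed

lemma prolongation_imp_locally_homogeneous:
  assumes \<Omega>: "lie_subgroupoid B \<Omega>"
    and prol: "integrable_nonholonomic_prolongation B (algebroid \<Omega>)"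
  shows "locally_homogeneous B \<Omega>"
  unfolding locally_homogeneous_def
proof
  fix x assume "x \<in> B"
  then obtain U P Q where U: "open U" "x \<in> U" "U \<subseteq> B" and P: "parallelism U P" and Q: "parallelism U Q"
    and int: "integrable_parallelism U Q"
    and A: "\<And>z v. z \<in> U \<Longrightarrow> induced_algebroid_map (prolongation U P Q) z v \<in> algebroid \<Omega> z"
    using prol unfolding integrable_nonholonomic_prolongation_def by meson
  define M where "M = (\<lambda>z. snd (snd (P z)))"
  define N where "N = (\<lambda>z. snd (snd (Q z)))"
  have M: "cocycle_on U M" and N: "cocycle_on U N"
    using P Q parallelism_iff_cocycle[OF U(1)] by (auto simp: M_def N_def)
  have A': "frechet_derivative (\<lambda>y. prolong_coords M N (y, z)) (at z) v \<in> algebroid \<Omega> z" if "z \<in> U" for z v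
    using A[OF that] by (simp add: induced_algebroid_map_prolongation[OF U(1) P Q that] M_def N_def)
  \<comment> \<open>Both base points are \<open>x\<close>, yet the two charts may still
    differ.\<close>
  obtain V1 \<psi>1 V2 \<psi>2 where ch: "chart_around U x V1 \<psi>1" "chart_around U x V2 \<psi>2"
    and Qch: "\<And>a b. a \<in> V1 \<Longrightarrow> b \<in> V2 \<Longrightarrow>
      Q (a, b) = pjet_of (inv_into V2 \<psi>2 \<circ> translation (\<psi>2 b - \<psi>1 a) \<circ> \<psi>1) a"
    using int U(2) unfolding integrable_parallelism_def by blast
  have V12: "x \<in> V1" "x \<in> V2" "V1 \<subseteq> U" "diffeo V1 (\<psi>1 ` V1) \<psi>1" "diffeo V2 (\<psi>2 ` V2) \<psi>2"
    using ch by (auto simp: chart_around_def)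
  then have "open (V1 \<inter> V2)" "x \<in> V1 \<inter> V2" by (auto simp: diffeo_def)
  then obtain r where r: "r > 0" "ball x r \<subseteq> V1 \<inter> V2" using open_contains_ball by blast
  define V where "V = ball x r"
  have V: "open V" "x \<in> V" "convex V" "V \<subseteq> U" "V \<subseteq> V1" "V \<subseteq> V2"
    using r V12(3) by (auto simp: V_def)
  let ?J1 = "\<lambda>a. matrix (frechet_derivative \<psi>1 (at a))" and ?J2 = "\<lambda>a. matrix (frechet_derivative \<psi>2 (at a))"
  have N12: "N (a, b) = matrix_inv (?J2 b) ** ?J1 a" if "a \<in> V" "b \<in> V" for a b
  proof -
    have ab: "a \<in> V1" "b \<in> V2" using that V by auto
    show ?thesis
      using Qch[OF ab] frechet_derivative_at[OF translation_in_charts(2)[OF V12(4) ab(1) V12(5) ab(2)], symmetric]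
      by (simp add: N_def pjet_of_def jacobian_at_def)
  qed
  \<comment> \<open>On the diagonal \<open>N\<close> is \<open>mat 1\<close>, which forces equal
    Jacobians; from here on \<open>\<psi>1\<close> alone represents \<open>N\<close>.\<close>
  have J: "?J2 a = ?J1 a" if "a \<in> V" for a
  proof -
    have inv: "invertible (?J2 a)"
      using that V(6) by (intro diffeo_invertible_jacobian[OF V12(5)]) auto
    have "matrix_inv (?J2 a) ** ?J1 a = mat 1"
      using N12[OF that that] cocycle_on_diagonal[OF N, of a] that V(4) by auto
    then have "?J2 a ** (matrix_inv (?J2 a) ** ?J1 a) = ?J2 a ** mat 1" by simp
    then show ?thesis by (simp add: matrix_mul_assoc matrix_inv[OF inv])
  qed
  \<comment> \<open>Freezing the second argument turns any cocycle into a quotient. For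
    \<open>N\<close> this would not be enough, because there the quotient must be formed from the
    Jacobians of a map, and that is what the chart provides.\<close>
  define p where "p = (\<lambda>a. M (a, x))"
  have p: "smooth_on V p" "\<And>a. a \<in> V \<Longrightarrow> invertible (p a)"
    using smooth_on_subset[OF smooth_on_fst_slice[OF U(1,1) cocycle_onD(1)[OF M] U(2)] V(4)]
      cocycle_onD(2)[OF M] V U(2) by (auto simp: p_def)
  have Mp: "M (a, b) = matrix_inv (p b) ** p a" if "a \<in> V" "b \<in> V" for a b
  proof -
    have "p a = p b ** M (a, b)"
      unfolding p_def using cocycle_onD(3)[OF M] that V(4) U(2) by blast
    then show ?thesis by (simp add: matrix_mul_assoc matrix_inv[OF p(2)[OF that(2)]])
  qed
  have dV: "diffeo V (\<psi>1 ` V) \<psi>1"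
    using V12(4) V by (intro diffeo_onto_image)
      (auto simp: diffeo_def bij_betw_def intro: smooth_on_subset inj_on_subset diffeo_invertible_jacobian[OF V12(4)])
  define \<kappa> where "\<kappa> = (\<lambda>X::frame. (\<psi>1 (fst X), p (fst X) ** snd X))"
  have \<kappa>: "deformation V \<kappa>"
    unfolding \<kappa>_def by (rule deformation_product_form[OF dV p])
  have "nhjet_of (inv_into (frame_bundle V) \<kappa> \<circ>
      frame_lift (translation (base_map \<kappa> b - base_map \<kappa> a)) \<circ> \<kappa>) a \<in> \<Omega>" if ab: "a \<in> V" "b \<in> V" for a b
  proof -
    have op: "open (V \<times> V)" using V(1) open_Times by blast
    \<comment> \<open>The last coordinate contains a derivative of the cocycle, so the identity
      \<open>Mp\<close> is used on the open set \<open>V \<times> V\<close> and not just at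
      \<open>(a, b)\<close>.\<close>
    have "M differentiable (at (a, b))"
      using smooth_on_has_derivative[OF cocycle_onD(1)[OF M], of "(a, b)"] ab V(4) differentiable_def by blast
    then have fr: "frechet_derivative M (at (a, b)) = frechet_derivative (quotient_cocycle p) (at (a, b))"
      by (rule frechet_derivative_transform_within_open[OF _ op]) (use Mp ab in auto)
    have "prolong_coords (quotient_cocycle p) (quotient_cocycle ?J1) (a, b) = prolong_coords M N (a, b)"
      using ab by (simp add: prolong_coords_def fr Mp N12 J)
    moreover have "jet (prolong_coords M N (a, b)) \<in> \<Omega>"
      by (rule prolong_coords_in_subgroupoid[OF \<Omega> U(1,3) M N A' V(3,4) ab])
    moreover have "\<psi>1 c = fst (\<kappa> (c, mat 1))" "p c = snd (\<kappa> (c, mat 1))" for c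
      by (simp_all add: \<kappa>_def)
    ultimately show ?thesis
      using homogeneity_jet[OF V(1) \<kappa> ab, of \<psi>1 p] by simp
  qed
  then have "homogeneous_on \<Omega> V" unfolding homogeneous_on_def using \<kappa> by blast
  then show "\<exists>U. open U \<and> x \<in> U \<and> U \<subseteq> B \<and> homogeneous_on \<Omega> U"
    using V(1,2,4) U(3) by blast
qed

theorem proposition9p2:
  fixes B :: "vec3 set" and W :: "nhjet \<Rightarrow> 'v::real_normed_vector"
  assumes "open B"
    and "mechanical_response B W"
    and "lie_subgroupoid B (material_groupoid B W)"
  shows "(homogeneous B (material_groupoid B W) \<longrightarrow>
           integrable_nonholonomic_prolongation B (algebroid (material_groupoid B W))) \<and>
         (integrable_nonholonomic_prolongation B (algebroid (material_groupoid B W)) \<longrightarrow>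
           locally_homogeneous B (material_groupoid B W))"
  using homogeneous_imp_prolongation[OF assms(1)] prolongation_imp_locally_homogeneous[OF assms(3)] by blast

end
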